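(* The category $\mathbf{SpanAut}$ of span automata is the free structured feedback category over the category of spans $\mathbf{Span}(\mathbf{FinSet})$ with the functor $\mathsf{U}_{\mathsf{AutSpan}}\colon\mathbf{Iso}(\mathbf{AutSt})\to\mathbf{Span}(\mathbf{FinSet})$ from isomorphisms of automaton state spaces; that is, there is an isomorphism of categories $$\mathbf{SpanAut}\;\cong\;\mathsf{St}(\mathbf{Span}(\mathbf{FinSet}),\mathsf{U}_{\mathsf{AutSpan}}).$$
   Context: Composition $f;g$ is in diagrammatic order; associators and unitors are suppressed. **Spans.** $\mathbf{Span}(\mathbf{FinSet})$ has finite sets as objects; a morphism $A\to B$ is an isomorphism class of spans $A\leftarrow E\to B$ of finite sets (isomorphisms of heads commuting with both legs); composition is by pullback; it is symmetric monoidal with tensor given by the cartesian product of sets. **Automaton state spaces.** An automaton state space $(S,i_S,f_S)$ is a finite set $S$ with an initial state $i_S\in S$ and a subset of final states $f_S\colon S\to 2$. The product of $(S,i_S,f_S)$ and $(T,i_T,f_T)$ is $(S\times T,(i_S,i_T),f_S\wedge f_T)$, with $(f_S\wedge f_T)(s,t)=f_S(s)\wedge f_T(t)$. A morphism $\alpha\colon(S,i_S,f_S)\to(T,i_T,f_T)$ is a function $\alpha\colon S\to T$ with $\alpha(i_S)=i_T$ and $f_T(\alpha(s))=f_S(s)$ for all $s$. These form the symmetric monoidal category $\mathbf{AutSt}$ (unit: the one-point set whose point is initial and final); $\mathbf{Iso}(\mathbf{AutSt})$ is its subcategory of isomorphisms. $\mathsf{U}_{\mathsf{AutSpan}}$ sends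 $(S,i_S,f_S)$ to $S$ and an isomorphism $\alpha\colon S\cong T$ to the span $S\xleftarrow{\mathrm{id}}S\xrightarrow{\alpha}T$. **Span automata.** $\mathbf{SpanAut}$ has finite sets as objects. A morphism $A\to B$ is a span automaton $\mathbf{X}=(E_X,S_X,A,B,s_X,t_X,l_X,r_X,i_X,f_X)$: a finite set of states $S_X$, a finite set of transitions $E_X$ with source and target $s_X,t_X\colon E_X\to S_X$, left and right labels $l_X\colon E_X\to A$, $r_X\colon E_X\to B$, an initial state $i_X\in S_X$ and a subset of final states $f_X\colon S_X\to 2$. Span automata are considered up to isomorphism: a bijection of state sets preserving initial and final states together with a bijection of transition sets, commuting with sources, targets and labels. The composition of $\mathbf{X}\colon A\to B$ and $\mathbf{Y}\colon B\to C$ is $(E_X\times_BE_Y,S_X\times S_Y,A,C,s_X\times s_Y,t_X\times t_Y,l_X,r_Y,(i_X,i_Y),f_X\wedge f_Y)$, where $E_X\times_BE_Y$ is the pullback of $r_X$ and $l_Y$ and the maps are restricted to (respectively precomposed with projections from) it. The monoidal product of $\mathbf{X}\colon A\to B$ and $\mathbf{Y}\colon A'\to B'$ is the componentwise product $(E_X\times E_Y,S_X\times S_Y,A\times A',B\times B',s_X\times s_Y,t_X\times t_Y,l_X\times l_Y,r_X\times r_Y,(i_X,i_Y),f_X\wedge f_Y)$. **Structured stateful processes.** For symmetric monoidal categories $(\mathbf{C},\otimes,I)$, $(\mathbf{S},\boxtimes,J)$ and a symmetric strong monoidal functor $\mathsf{R}\colon\mathbf{S}\to\mathbf{C}$, $\mathsf{St}(\mathbf{C},\mathsf{R})$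 has the objects of $\mathbf{C}$; morphisms $A\to B$ are pairs $(S\mid f)$ with $S\in\mathbf{S}$ and $f\colon\mathsf{R}S\otimes A\to\mathsf{R}S\otimes B$, modulo the equivalence relation generated by $(S\mid(\mathsf{R}h\otimes \mathrm{id});f)\sim(T\mid f;(\mathsf{R}h\otimes \mathrm{id}))$ for $h\colon S\to T$ in $\mathbf{S}$ and $f\colon\mathsf{R}T\otimes A\to\mathsf{R}S\otimes B$. Up to the coherence isomorphisms of $\mathsf{R}$: the identity is $(J\mid \mathrm{id})$; $(S\mid f);(T\mid g)=(S\boxtimes T\mid(\sigma\otimes \mathrm{id});(\mathrm{id}\otimes f);(\sigma\otimes \mathrm{id});(\mathrm{id}\otimes g))$; $(S\mid f)\otimes(S'\mid f')=(S\boxtimes S'\mid(\mathrm{id}\otimes\sigma\otimes \mathrm{id});(f\otimes f');(\mathrm{id}\otimes\sigma\otimes \mathrm{id}))$, where $\sigma$ is the symmetry. The category $\mathsf{St}(\mathbf{C},\mathsf{R})$, with the operator $\mathsf{store}_T(S\mid f)=(S\boxtimes T\mid f)$, is what is called the free structured feedback category over $\mathsf{R}$. **Isomorphism of categories.** A symmetric strong monoidal functor that is fully faithful and bijective on objects. *)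

theory Defs
  imports Main "HOL-Library.FuncSet"
begin

section \<open>Symmetric monoidal categories and functors\<close>

text \<open>Composition is written in diagrammatic order. Associators and unitors are explicit:
  \<open>Assoc A B C : (A \<otimes> B) \<otimes> C \<rightarrow> A \<otimes> (B \<otimes> C)\<close>, \<open>LUnit A : I \<otimes> A \<rightarrow> A\<close>,
  \<open>RUnit A : A \<otimes> I \<rightarrow> A\<close>, \<open>Symm A B : A \<otimes> B \<rightarrow> B \<otimes> A\<close>.\<close>

record ('o, 'm) smcat =
  Obj :: "'o set"
  Arr :: "'m set"
  Dom :: "'m \<Rightarrow> 'o"
  Cod :: "'m \<Rightarrow> 'o"
  ident :: "'o \<Rightarrow> 'm"
  comp :: "'m \<Rightarrow> 'm \<Rightarrow> 'm" (infixl "\<Zcomp>\<index>" 60)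
  otens :: "'o \<Rightarrow> 'o \<Rightarrow> 'o" (infixr "\<otimes>\<index>" 70)
  atens :: "'m \<Rightarrow> 'm \<Rightarrow> 'm" (infixr "\<boxtimes>\<index>" 70)
  Unity :: "'o"
  Assoc :: "'o \<Rightarrow> 'o \<Rightarrow> 'o \<Rightarrow> 'm"
  LUnit :: "'o \<Rightarrow> 'm"
  RUnit :: "'o \<Rightarrow> 'm"
  Symm :: "'o \<Rightarrow> 'o \<Rightarrow> 'm"

definition hom :: "('o, 'm) smcat \<Rightarrow> 'o \<Rightarrow> 'o \<Rightarrow> 'm set" where
  "hom C A B = {f \<in> Arr C. Dom C f = A \<and> Cod C f = B}"

definition inverse_arrs :: "('o, 'm) smcat \<Rightarrow> 'm \<Rightarrow> 'm \<Rightarrow> bool" where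
  "inverse_arrs C f g \<longleftrightarrow> g \<in> hom C (Cod C f) (Dom C f) \<and>
     f \<Zcomp>\<^bsub>C\<^esub> g = ident C (Dom C f) \<and> g \<Zcomp>\<^bsub>C\<^esub> f = ident C (Cod C f)"

definition is_iso :: "('o, 'm) smcat \<Rightarrow> 'm \<Rightarrow> bool" where
  "is_iso C f \<longleftrightarrow> f \<in> Arr C \<and> (\<exists>g. inverse_arrs C f g)"

definition inv_arr :: "('o, 'm) smcat \<Rightarrow> 'm \<Rightarrow> 'm" where
  "inv_arr C f = (THE g. inverse_arrs C f g)"

locale category =
  fixes C :: "('o, 'm) smcat" (structure)
  assumes Dom_Obj: "f \<in> Arr C \<Longrightarrow> Dom C f \<in> Obj C"
    and Cod_Obj: "f \<in> Arr C \<Longrightarrow> Cod C f \<in> Obj C"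
    and ident_hom: "A \<in> Obj C \<Longrightarrow> ident C A \<in> hom C A A"
    and comp_hom: "f \<in> hom C A B \<Longrightarrow> g \<in> hom C B D \<Longrightarrow> f \<Zcomp> g \<in> hom C A D"
    and ident_left: "f \<in> hom C A B \<Longrightarrow> ident C A \<Zcomp> f = f"
    and ident_right: "f \<in> hom C A B \<Longrightarrow> f \<Zcomp> ident C B = f"
    and comp_assoc: "f \<in> hom C A B \<Longrightarrow> g \<in> hom C B D \<Longrightarrow> h \<in> hom C D E \<Longrightarrow>
      (f \<Zcomp> g) \<Zcomp> h = f \<Zcomp> (g \<Zcomp> h)"

locale symmetric_monoidal_category = category +
  assumes otens_Obj: "A \<in> Obj C \<Longrightarrow> B \<in> Obj C \<Longrightarrow> A \<otimes> B \<in> Obj C"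
    and Unity_Obj: "Unity C \<in> Obj C"
    and atens_hom: "f \<in> hom C A B \<Longrightarrow> g \<in> hom C A' B' \<Longrightarrow> f \<boxtimes> g \<in> hom C (A \<otimes> A') (B \<otimes> B')"
    and atens_ident: "A \<in> Obj C \<Longrightarrow> B \<in> Obj C \<Longrightarrow> ident C A \<boxtimes> ident C B = ident C (A \<otimes> B)"
    and atens_comp: "f \<in> hom C A B \<Longrightarrow> g \<in> hom C B D \<Longrightarrow> f' \<in> hom C A' B' \<Longrightarrow> g' \<in> hom C B' D' \<Longrightarrow>
      (f \<Zcomp> g) \<boxtimes> (f' \<Zcomp> g') = (f \<boxtimes> f') \<Zcomp> (g \<boxtimes> g')"
    and Assoc_hom: "A \<in> Obj C \<Longrightarrow> B \<in> Obj C \<Longrightarrow> D \<in> Obj C \<Longrightarrow>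
      Assoc C A B D \<in> hom C ((A \<otimes> B) \<otimes> D) (A \<otimes> (B \<otimes> D))"
    and Assoc_iso: "A \<in> Obj C \<Longrightarrow> B \<in> Obj C \<Longrightarrow> D \<in> Obj C \<Longrightarrow> is_iso C (Assoc C A B D)"
    and Assoc_nat: "f \<in> hom C A A' \<Longrightarrow> g \<in> hom C B B' \<Longrightarrow> h \<in> hom C D D' \<Longrightarrow>
      ((f \<boxtimes> g) \<boxtimes> h) \<Zcomp> Assoc C A' B' D' = Assoc C A B D \<Zcomp> (f \<boxtimes> (g \<boxtimes> h))"
    and LUnit_hom: "A \<in> Obj C \<Longrightarrow> LUnit C A \<in> hom C (Unity C \<otimes> A) A"
    and LUnit_iso: "A \<in> Obj C \<Longrightarrow> is_iso C (LUnit C A)"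
    and LUnit_nat: "f \<in> hom C A B \<Longrightarrow>
      (ident C (Unity C) \<boxtimes> f) \<Zcomp> LUnit C B = LUnit C A \<Zcomp> f"
    and RUnit_hom: "A \<in> Obj C \<Longrightarrow> RUnit C A \<in> hom C (A \<otimes> Unity C) A"
    and RUnit_iso: "A \<in> Obj C \<Longrightarrow> is_iso C (RUnit C A)"
    and RUnit_nat: "f \<in> hom C A B \<Longrightarrow>
      (f \<boxtimes> ident C (Unity C)) \<Zcomp> RUnit C B = RUnit C A \<Zcomp> f"
    and Symm_hom: "A \<in> Obj C \<Longrightarrow> B \<in> Obj C \<Longrightarrow> Symm C A B \<in> hom C (A \<otimes> B) (B \<otimes> A)"
    and Symm_nat: "f \<in> hom C A A' \<Longrightarrow> g \<in> hom C B B' \<Longrightarrow>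
      (f \<boxtimes> g) \<Zcomp> Symm C A' B' = Symm C A B \<Zcomp> (g \<boxtimes> f)"
    and Symm_Symm: "A \<in> Obj C \<Longrightarrow> B \<in> Obj C \<Longrightarrow> Symm C A B \<Zcomp> Symm C B A = ident C (A \<otimes> B)"
    and pentagon: "A \<in> Obj C \<Longrightarrow> B \<in> Obj C \<Longrightarrow> D \<in> Obj C \<Longrightarrow> E \<in> Obj C \<Longrightarrow>
      Assoc C (A \<otimes> B) D E \<Zcomp> Assoc C A B (D \<otimes> E) =
      (Assoc C A B D \<boxtimes> ident C E) \<Zcomp> Assoc C A (B \<otimes> D) E \<Zcomp> (ident C A \<boxtimes> Assoc C B D E)"
    and triangle: "A \<in> Obj C \<Longrightarrow> B \<in> Obj C \<Longrightarrow>
      Assoc C A (Unity C) B \<Zcomp> (ident C A \<boxtimes> LUnit C B) = RUnit C A \<boxtimes> ident C B"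
    and hexagon: "A \<in> Obj C \<Longrightarrow> B \<in> Obj C \<Longrightarrow> D \<in> Obj C \<Longrightarrow>
      Assoc C A B D \<Zcomp> Symm C A (B \<otimes> D) \<Zcomp> Assoc C B D A =
      (Symm C A B \<boxtimes> ident C D) \<Zcomp> Assoc C B A D \<Zcomp> (ident C B \<boxtimes> Symm C A D)"

text \<open>A strong monoidal functor \<open>F\<close> carries structure isomorphisms
  \<open>Mult F A B : F A \<otimes> F B \<rightarrow> F (A \<otimes> B)\<close> and \<open>UnitMap F : I \<rightarrow> F I\<close>.\<close>

record ('o, 'm, 'p, 'n) monfun =
  OMap :: "'o \<Rightarrow> 'p"
  AMap :: "'m \<Rightarrow> 'n"
  Mult :: "'o \<Rightarrow> 'o \<Rightarrow> 'n"
  UnitMap :: "'n"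

locale symmetric_strong_monoidal_functor =
  C: symmetric_monoidal_category C + D: symmetric_monoidal_category D
  for C :: "('o, 'm) smcat" and D :: "('p, 'n) smcat" (structure) +
  fixes F :: "('o, 'm, 'p, 'n) monfun"
  assumes OMap_Obj: "A \<in> Obj C \<Longrightarrow> OMap F A \<in> Obj D"
    and AMap_hom: "f \<in> hom C A B \<Longrightarrow> AMap F f \<in> hom D (OMap F A) (OMap F B)"
    and AMap_ident: "A \<in> Obj C \<Longrightarrow> AMap F (ident C A) = ident D (OMap F A)"
    and AMap_comp: "f \<in> hom C A B \<Longrightarrow> g \<in> hom C B E \<Longrightarrow>
      AMap F (f \<Zcomp>\<^bsub>C\<^esub> g) = AMap F f \<Zcomp> AMap F g"
    and Mult_hom: "A \<in> Obj C \<Longrightarrow> B \<in> Obj C \<Longrightarrow>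
      Mult F A B \<in> hom D (OMap F A \<otimes> OMap F B) (OMap F (A \<otimes>\<^bsub>C\<^esub> B))"
    and Mult_iso: "A \<in> Obj C \<Longrightarrow> B \<in> Obj C \<Longrightarrow> is_iso D (Mult F A B)"
    and Mult_nat: "f \<in> hom C A A' \<Longrightarrow> g \<in> hom C B B' \<Longrightarrow>
      (AMap F f \<boxtimes> AMap F g) \<Zcomp> Mult F A' B' = Mult F A B \<Zcomp> AMap F (f \<boxtimes>\<^bsub>C\<^esub> g)"
    and UnitMap_hom: "UnitMap F \<in> hom D (Unity D) (OMap F (Unity C))"
    and UnitMap_iso: "is_iso D (UnitMap F)"
    and Mult_Assoc: "A \<in> Obj C \<Longrightarrow> B \<in> Obj C \<Longrightarrow> E \<in> Obj C \<Longrightarrow>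
      (Mult F A B \<boxtimes> ident D (OMap F E)) \<Zcomp> Mult F (A \<otimes>\<^bsub>C\<^esub> B) E \<Zcomp> AMap F (Assoc C A B E) =
      Assoc D (OMap F A) (OMap F B) (OMap F E) \<Zcomp>
        (ident D (OMap F A) \<boxtimes> Mult F B E) \<Zcomp> Mult F A (B \<otimes>\<^bsub>C\<^esub> E)"
    and Mult_LUnit: "A \<in> Obj C \<Longrightarrow>
      (UnitMap F \<boxtimes> ident D (OMap F A)) \<Zcomp> Mult F (Unity C) A \<Zcomp> AMap F (LUnit C A) =
      LUnit D (OMap F A)"
    and Mult_RUnit: "A \<in> Obj C \<Longrightarrow>
      (ident D (OMap F A) \<boxtimes> UnitMap F) \<Zcomp> Mult F A (Unity C) \<Zcomp> AMap F (RUnit C A) =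
      RUnit D (OMap F A)"
    and Mult_Symm: "A \<in> Obj C \<Longrightarrow> B \<in> Obj C \<Longrightarrow>
      Mult F A B \<Zcomp> AMap F (Symm C A B) = Symm D (OMap F A) (OMap F B) \<Zcomp> Mult F B A"

definition isomorphic_categories :: "('o, 'm) smcat \<Rightarrow> ('p, 'n) smcat \<Rightarrow> bool" (infix "\<cong>\<^sub>c" 50) where
  "C \<cong>\<^sub>c D \<longleftrightarrow> (\<exists>F. symmetric_strong_monoidal_functor C D F \<and>
     bij_betw (OMap F) (Obj C) (Obj D) \<and>
     (\<forall>A\<in>Obj C. \<forall>B\<in>Obj C. bij_betw (AMap F) (hom C A B) (hom D (OMap F A) (OMap F B))))"

text \<open>The subcategory of isomorphisms.\<close>

definition Iso :: "('o, 'm) smcat \<Rightarrow> ('o, 'm) smcat" where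
  "Iso C = C\<lparr>Arr := {f \<in> Arr C. is_iso C f}\<rparr>"


section \<open>Structured stateful processes\<close>

context
  fixes C :: "('o, 'm) smcat" (structure)
    and S :: "('p, 'n) smcat"
    and R :: "('p, 'n, 'o, 'm) monfun"
begin

text \<open>\<open>(W \<otimes> X) \<otimes> (Y \<otimes> Z) \<rightarrow> (W \<otimes> Y) \<otimes> (X \<otimes> Z)\<close>, i.e. \<open>id \<otimes> \<sigma> \<otimes> id\<close> up to associators.\<close>

definition interchange :: "'o \<Rightarrow> 'o \<Rightarrow> 'o \<Rightarrow> 'o \<Rightarrow> 'm" where
  "interchange W X Y Z =
     Assoc C W X (Y \<otimes> Z) \<Zcomp>
     (ident C W \<boxtimes> (inv_arr C (Assoc C X Y Z) \<Zcomp> (Symm C X Y \<boxtimes> ident C Z) \<Zcomp> Assoc C Y X Z)) \<Zcomp>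
     inv_arr C (Assoc C W Y (X \<otimes> Z))"

definition st_pairs :: "'o \<Rightarrow> 'o \<Rightarrow> ('p \<times> 'm) set" where
  "st_pairs A B = {(s, f). s \<in> Obj S \<and> f \<in> hom C (OMap R s \<otimes> A) (OMap R s \<otimes> B)}"

definition st_slide :: "'o \<Rightarrow> 'o \<Rightarrow> (('p \<times> 'm) \<times> ('p \<times> 'm)) set" where
  "st_slide A B =
     {((s, (AMap R h \<boxtimes> ident C A) \<Zcomp> f), (t, f \<Zcomp> (AMap R h \<boxtimes> ident C B))) | s t h f.
        s \<in> Obj S \<and> t \<in> Obj S \<and> h \<in> hom S s t \<and> f \<in> hom C (OMap R t \<otimes> A) (OMap R s \<otimes> B)}"

definition st_equiv :: "'o \<Rightarrow> 'o \<Rightarrow> (('p \<times> 'm) \<times> ('p \<times> 'm)) set" where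
  "st_equiv A B = (st_slide A B \<union> (st_slide A B)\<inverse>)\<^sup>* \<inter> (st_pairs A B \<times> st_pairs A B)"

definition st_seq :: "'o \<Rightarrow> 'o \<Rightarrow> 'o \<Rightarrow> 'p \<times> 'm \<Rightarrow> 'p \<times> 'm \<Rightarrow> 'p \<times> 'm" where
  "st_seq A B D x y = (case (x, y) of ((s, f), (t, g)) \<Rightarrow>
     let X = OMap R s; Y = OMap R t in
     (s \<otimes>\<^bsub>S\<^esub> t,
      (inv_arr C (Mult R s t) \<boxtimes> ident C A) \<Zcomp>
      (Symm C X Y \<boxtimes> ident C A) \<Zcomp>
      Assoc C Y X A \<Zcomp> (ident C Y \<boxtimes> f) \<Zcomp> inv_arr C (Assoc C Y X B) \<Zcomp>
      (Symm C Y X \<boxtimes> ident C B) \<Zcomp>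
      Assoc C X Y B \<Zcomp> (ident C X \<boxtimes> g) \<Zcomp> inv_arr C (Assoc C X Y D) \<Zcomp>
      (Mult R s t \<boxtimes> ident C D)))"

definition st_par :: "'o \<Rightarrow> 'o \<Rightarrow> 'o \<Rightarrow> 'o \<Rightarrow> 'p \<times> 'm \<Rightarrow> 'p \<times> 'm \<Rightarrow> 'p \<times> 'm" where
  "st_par A B A' B' x x' = (case (x, x') of ((s, f), (s', f')) \<Rightarrow>
     let X = OMap R s; X' = OMap R s' in
     (s \<otimes>\<^bsub>S\<^esub> s',
      (inv_arr C (Mult R s s') \<boxtimes> ident C (A \<otimes> A')) \<Zcomp>
      interchange X X' A A' \<Zcomp> (f \<boxtimes> f') \<Zcomp> interchange X B X' B' \<Zcomp>
      (Mult R s s' \<boxtimes> ident C (B \<otimes> B'))))"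

text \<open>Arrows \<open>A \<rightarrow> B\<close> are triples \<open>(A, B, X)\<close> with \<open>X\<close> an equivalence class of pairs. The
  operations on classes are unions of the classes obtained from all representatives.
  The associators, unitors and symmetries are those of \<open>C\<close>, included as processes with state \<open>J\<close>.\<close>

definition st_arr :: "'o \<Rightarrow> 'o \<Rightarrow> 'p \<times> 'm \<Rightarrow> 'o \<times> 'o \<times> ('p \<times> 'm) set" where
  "st_arr A B x = (A, B, st_equiv A B `` {x})"

definition st_incl :: "'m \<Rightarrow> 'o \<times> 'o \<times> ('p \<times> 'm) set" where
  "st_incl f = st_arr (Dom C f) (Cod C f) (Unity S, ident C (OMap R (Unity S)) \<boxtimes> f)"

definition St :: "('o, 'o \<times> 'o \<times> ('p \<times> 'm) set) smcat" where
  "St = \<lparr>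
     Obj = Obj C,
     Arr = {(A, B, X). A \<in> Obj C \<and> B \<in> Obj C \<and> X \<in> st_pairs A B // st_equiv A B},
     Dom = (\<lambda>(A, B, X). A),
     Cod = (\<lambda>(A, B, X). B),
     ident = (\<lambda>A. st_arr A A (Unity S, ident C (OMap R (Unity S) \<otimes> A))),
     comp = (\<lambda>(A, B, X) (B', D, Y).
       (A, D, \<Union>x\<in>X. \<Union>y\<in>Y. st_equiv A D `` {st_seq A B D x y})),
     otens = (\<lambda>A B. A \<otimes> B),
     atens = (\<lambda>(A, B, X) (A', B', X').
       (A \<otimes> A', B \<otimes> B', \<Union>x\<in>X. \<Union>x'\<in>X'. st_equiv (A \<otimes> A') (B \<otimes> B') `` {st_par A B A' B' x x'})),
     Unity = Unity C,
     Assoc = (\<lambda>A B D. st_incl (Assoc C A B D)),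
     LUnit = (\<lambda>A. st_incl (LUnit C A)),
     RUnit = (\<lambda>A. st_incl (RUnit C A)),
     Symm = (\<lambda>A B. st_incl (Symm C A B))\<rparr>"

end


section \<open>A universe of elements closed under pairing\<close>

text \<open>All finite sets live in this type, so that cartesian products stay in it; the parameter
  \<open>'a\<close> supplies arbitrary atoms.\<close>

datatype 'a elem = Atom 'a | Point | Pr (p1: "'a elem") (p2: "'a elem")

definition pairs :: "'a elem set \<Rightarrow> 'a elem set \<Rightarrow> 'a elem set" where
  "pairs A B = {Pr a b | a b. a \<in> A \<and> b \<in> B}"

definition map_pr :: "('a elem \<Rightarrow> 'a elem) \<Rightarrow> ('a elem \<Rightarrow> 'a elem) \<Rightarrow> 'a elem \<Rightarrow> 'a elem" where
  "map_pr f g e = Pr (f (p1 e)) (g (p2 e))"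

definition assoc_pr :: "'a elem \<Rightarrow> 'a elem" where
  "assoc_pr e = Pr (p1 (p1 e)) (Pr (p2 (p1 e)) (p2 e))"

definition swap_pr :: "'a elem \<Rightarrow> 'a elem" where
  "swap_pr e = Pr (p2 e) (p1 e)"


section \<open>Spans of finite sets\<close>

record 'a span =
  Head :: "'a elem set"
  Lleg :: "'a elem \<Rightarrow> 'a elem"
  Rleg :: "'a elem \<Rightarrow> 'a elem"

definition spans :: "'a elem set \<Rightarrow> 'a elem set \<Rightarrow> 'a span set" where
  "spans A B = {x. finite (Head x) \<and> Lleg x \<in> Head x \<rightarrow> A \<and> Rleg x \<in> Head x \<rightarrow> B}"

definition span_iso :: "'a elem set \<Rightarrow> 'a elem set \<Rightarrow> ('a span \<times> 'a span) set" where
  "span_iso A B = {(x, y). x \<in> spans A B \<and> y \<in> spans A B \<and>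
     (\<exists>\<phi>. bij_betw \<phi> (Head x) (Head y) \<and>
        (\<forall>e\<in>Head x. Lleg y (\<phi> e) = Lleg x e \<and> Rleg y (\<phi> e) = Rleg x e))}"

definition span_comp :: "'a span \<Rightarrow> 'a span \<Rightarrow> 'a span" where
  "span_comp x y =
     \<lparr>Head = {e \<in> pairs (Head x) (Head y). Rleg x (p1 e) = Lleg y (p2 e)},
      Lleg = (\<lambda>e. Lleg x (p1 e)), Rleg = (\<lambda>e. Rleg y (p2 e))\<rparr>"

definition span_prod :: "'a span \<Rightarrow> 'a span \<Rightarrow> 'a span" where
  "span_prod x y =
     \<lparr>Head = pairs (Head x) (Head y),
      Lleg = map_pr (Lleg x) (Lleg y), Rleg = map_pr (Rleg x) (Rleg y)\<rparr>"

type_synonym 'a span_class = "'a elem set \<times> 'a elem set \<times> 'a span set"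

text \<open>The class of the span \<open>A \<leftarrow> A \<rightarrow> B\<close> with left leg the identity and right leg \<open>f\<close>.\<close>

definition fun_span :: "'a elem set \<Rightarrow> 'a elem set \<Rightarrow> ('a elem \<Rightarrow> 'a elem) \<Rightarrow> 'a span_class" where
  "fun_span A B f = (A, B, span_iso A B `` {\<lparr>Head = A, Lleg = id, Rleg = f\<rparr>})"

definition Span_FinSet :: "('a elem set, 'a span_class) smcat" where
  "Span_FinSet = \<lparr>
     Obj = {A. finite A},
     Arr = {(A, B, X). finite A \<and> finite B \<and> X \<in> spans A B // span_iso A B},
     Dom = (\<lambda>(A, B, X). A),
     Cod = (\<lambda>(A, B, X). B),
     ident = (\<lambda>A. fun_span A A id),
     comp = (\<lambda>(A, B, X) (B', D, Y).
       (A, D, \<Union>x\<in>X. \<Union>y\<in>Y. span_iso A D `` {span_comp x y})),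
     otens = pairs,
     atens = (\<lambda>(A, B, X) (A', B', X').
       (pairs A A', pairs B B',
        \<Union>x\<in>X. \<Union>x'\<in>X'. span_iso (pairs A A') (pairs B B') `` {span_prod x x'})),
     Unity = {Point},
     Assoc = (\<lambda>A B D. fun_span (pairs (pairs A B) D) (pairs A (pairs B D)) assoc_pr),
     LUnit = (\<lambda>A. fun_span (pairs {Point} A) A p2),
     RUnit = (\<lambda>A. fun_span (pairs A {Point}) A p1),
     Symm = (\<lambda>A B. fun_span (pairs A B) (pairs B A) swap_pr)\<rparr>"


section \<open>Automaton state spaces\<close>

text \<open>The map \<open>f\<^sub>S : S \<rightarrow> 2\<close> is given by the subset of final states.\<close>

record 'a aut_space =
  States :: "'a elem set"
  Init :: "'a elem"
  Finals :: "'a elem set"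

definition aut_spaces :: "'a aut_space set" where
  "aut_spaces = {s. finite (States s) \<and> Init s \<in> States s \<and> Finals s \<subseteq> States s}"

definition aut_space_prod :: "'a aut_space \<Rightarrow> 'a aut_space \<Rightarrow> 'a aut_space" where
  "aut_space_prod s t =
     \<lparr>States = pairs (States s) (States t), Init = Pr (Init s) (Init t),
      Finals = pairs (Finals s) (Finals t)\<rparr>"

definition aut_space_unit :: "'a aut_space" where
  "aut_space_unit = \<lparr>States = {Point}, Init = Point, Finals = {Point}\<rparr>"

type_synonym 'a aut_map = "'a aut_space \<times> 'a aut_space \<times> ('a elem \<Rightarrow> 'a elem)"

definition aut_map :: "'a aut_space \<Rightarrow> 'a aut_space \<Rightarrow> ('a elem \<Rightarrow> 'a elem) \<Rightarrow> 'a aut_map" where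
  "aut_map s t \<alpha> = (s, t, restrict \<alpha> (States s))"

definition AutSt :: "('a aut_space, 'a aut_map) smcat" where
  "AutSt = \<lparr>
     Obj = aut_spaces,
     Arr = {(s, t, \<alpha>). s \<in> aut_spaces \<and> t \<in> aut_spaces \<and> \<alpha> \<in> States s \<rightarrow>\<^sub>E States t \<and>
       \<alpha> (Init s) = Init t \<and> (\<forall>x\<in>States s. \<alpha> x \<in> Finals t \<longleftrightarrow> x \<in> Finals s)},
     Dom = (\<lambda>(s, t, \<alpha>). s),
     Cod = (\<lambda>(s, t, \<alpha>). t),
     ident = (\<lambda>s. aut_map s s id),
     comp = (\<lambda>(s, t, \<alpha>) (t', u, \<beta>). aut_map s u (\<beta> \<circ> \<alpha>)),
     otens = aut_space_prod,
     atens = (\<lambda>(s, t, \<alpha>) (s', t', \<alpha>').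
       aut_map (aut_space_prod s s') (aut_space_prod t t') (map_pr \<alpha> \<alpha>')),
     Unity = aut_space_unit,
     Assoc = (\<lambda>s t u. aut_map (aut_space_prod (aut_space_prod s t) u)
       (aut_space_prod s (aut_space_prod t u)) assoc_pr),
     LUnit = (\<lambda>s. aut_map (aut_space_prod aut_space_unit s) s p2),
     RUnit = (\<lambda>s. aut_map (aut_space_prod s aut_space_unit) s p1),
     Symm = (\<lambda>s t. aut_map (aut_space_prod s t) (aut_space_prod t s) swap_pr)\<rparr>"

definition U_AutSpan :: "('a aut_space, 'a aut_map, 'a elem set, 'a span_class) monfun" where
  "U_AutSpan = \<lparr>
     OMap = States,
     AMap = (\<lambda>(s, t, \<alpha>). fun_span (States s) (States t) \<alpha>),
     Mult = (\<lambda>s t. ident Span_FinSet (pairs (States s) (States t))),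
     UnitMap = ident Span_FinSet {Point}\<rparr>"


section \<open>Span automata\<close>

record 'a span_aut =
  Trans :: "'a elem set"
  space :: "'a aut_space"
  Src :: "'a elem \<Rightarrow> 'a elem"
  Tgt :: "'a elem \<Rightarrow> 'a elem"
  Llab :: "'a elem \<Rightarrow> 'a elem"
  Rlab :: "'a elem \<Rightarrow> 'a elem"

definition span_auts :: "'a elem set \<Rightarrow> 'a elem set \<Rightarrow> 'a span_aut set" where
  "span_auts A B = {x. finite (Trans x) \<and> space x \<in> aut_spaces \<and>
     Src x \<in> Trans x \<rightarrow> States (space x) \<and> Tgt x \<in> Trans x \<rightarrow> States (space x) \<and>
     Llab x \<in> Trans x \<rightarrow> A \<and> Rlab x \<in> Trans x \<rightarrow> B}"

definition span_aut_iso :: "'a elem set \<Rightarrow> 'a elem set \<Rightarrow> ('a span_aut \<times> 'a span_aut) set" where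
  "span_aut_iso A B = {(x, y). x \<in> span_auts A B \<and> y \<in> span_auts A B \<and>
     (\<exists>\<alpha> \<phi>. bij_betw \<alpha> (States (space x)) (States (space y)) \<and>
        \<alpha> (Init (space x)) = Init (space y) \<and>
        (\<forall>s\<in>States (space x). \<alpha> s \<in> Finals (space y) \<longleftrightarrow> s \<in> Finals (space x)) \<and>
        bij_betw \<phi> (Trans x) (Trans y) \<and>
        (\<forall>e\<in>Trans x. Src y (\<phi> e) = \<alpha> (Src x e) \<and> Tgt y (\<phi> e) = \<alpha> (Tgt x e) \<and>
           Llab y (\<phi> e) = Llab x e \<and> Rlab y (\<phi> e) = Rlab x e))}"

definition span_aut_comp :: "'a span_aut \<Rightarrow> 'a span_aut \<Rightarrow> 'a span_aut" where
  "span_aut_comp x y =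
     \<lparr>Trans = {e \<in> pairs (Trans x) (Trans y). Rlab x (p1 e) = Llab y (p2 e)},
      space = aut_space_prod (space x) (space y),
      Src = map_pr (Src x) (Src y), Tgt = map_pr (Tgt x) (Tgt y),
      Llab = (\<lambda>e. Llab x (p1 e)), Rlab = (\<lambda>e. Rlab y (p2 e))\<rparr>"

definition span_aut_prod :: "'a span_aut \<Rightarrow> 'a span_aut \<Rightarrow> 'a span_aut" where
  "span_aut_prod x y =
     \<lparr>Trans = pairs (Trans x) (Trans y),
      space = aut_space_prod (space x) (space y),
      Src = map_pr (Src x) (Src y), Tgt = map_pr (Tgt x) (Tgt y),
      Llab = map_pr (Llab x) (Llab y), Rlab = map_pr (Rlab x) (Rlab y)\<rparr>"

type_synonym 'a span_aut_class = "'a elem set \<times> 'a elem set \<times> 'a span_aut set"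

text \<open>The class of the one-state automaton with transitions \<open>A\<close>, left label the identity and
  right label \<open>f\<close>. The identities and the structure isomorphisms of the monoidal category of span
  automata are of this form.\<close>

definition fun_span_aut :: "'a elem set \<Rightarrow> 'a elem set \<Rightarrow> ('a elem \<Rightarrow> 'a elem) \<Rightarrow> 'a span_aut_class" where
  "fun_span_aut A B f = (A, B, span_aut_iso A B `` {\<lparr>Trans = A, space = aut_space_unit,
     Src = (\<lambda>_. Point), Tgt = (\<lambda>_. Point), Llab = id, Rlab = f\<rparr>})"

definition SpanAut :: "('a elem set, 'a span_aut_class) smcat" where
  "SpanAut = \<lparr>
     Obj = {A. finite A},
     Arr = {(A, B, X). finite A \<and> finite B \<and> X \<in> span_auts A B // span_aut_iso A B},
     Dom = (\<lambda>(A, B, X). A),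
     Cod = (\<lambda>(A, B, X). B),
     ident = (\<lambda>A. fun_span_aut A A id),
     comp = (\<lambda>(A, B, X) (B', D, Y).
       (A, D, \<Union>x\<in>X. \<Union>y\<in>Y. span_aut_iso A D `` {span_aut_comp x y})),
     otens = pairs,
     atens = (\<lambda>(A, B, X) (A', B', X').
       (pairs A A', pairs B B',
        \<Union>x\<in>X. \<Union>x'\<in>X'. span_aut_iso (pairs A A') (pairs B B') `` {span_aut_prod x x'})),
     Unity = {Point},
     Assoc = (\<lambda>A B D. fun_span_aut (pairs (pairs A B) D) (pairs A (pairs B D)) assoc_pr),
     LUnit = (\<lambda>A. fun_span_aut (pairs {Point} A) A p2),
     RUnit = (\<lambda>A. fun_span_aut (pairs A {Point}) A p1),
     Symm = (\<lambda>A B. fun_span_aut (pairs A B) (pairs B A) swap_pr)\<rparr>"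

end

theory Submission
  imports Defs
begin

text \<open>A span \<open>S \<times> A \<leftarrow> E \<rightarrow> S \<times> B\<close> is the same as a set of transitions \<open>E\<close> with source and
  left label on one leg, target and right label on the other, so processes with state space \<open>S\<close>
  are span automata. Sliding along an isomorphism \<open>h\<close> of state spaces renames the states by \<open>h\<close>;
  hence the equivalence of processes is isomorphism of automata, and in the composite of processes
  the pullbacks force the unused state component along, which leaves \<open>E\<^sub>X \<times>\<^sub>B E\<^sub>Y\<close>.

  The monoidal axioms are checked only for span automata. A strict functor that is faithful (but
  possibly not injective on objects) reflects all equational axioms. Spans embed faithfully into
  span automata as the automata with one state, isomorphisms of state spaces embed into spans, and
  the comparison with stateful processes transports the axioms to these.\<close>

section \<open>Faithful strict functors reflect monoidal structure\<close>

text \<open>Verifying the axioms of \<open>St\<close> directly would mean manipulating, inside a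
  quotient, ten span classes for every composition. For automata each axiom amounts to rearranging
  tuples of states and transitions, and this is why they are the hub of the proof.

  A faithful functor reflects equations between parallel arrows. It reflects neither typing nor
  invertibility, since an inverse in the target need not come from an arrow of the source. So
  \<open>monoidal_signature\<close> collects exactly these parts, including
  \<open>Assoc_iso\<close>, \<open>LUnit_iso\<close> and \<open>RUnit_iso\<close>, to be supplied by
  hand for each category.

  On underlying sets every tensor is the same operation \<open>pairs\<close>, so all functors
  involved preserve tensors on the nose and their comparison maps are identities.

  The correspondence with processes is used in both directions. \<open>from_St\<close> ends in a
  category whose axioms are known, so it yields those of \<open>St\<close>; only afterwards can
  \<open>to_St\<close> be stated as a functor into a symmetric monoidal category.\<close>

locale monoidal_signature =
  fixes C :: "('o, 'm) smcat" (structure)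
  assumes Dom_Obj: "f \<in> Arr C \<Longrightarrow> Dom C f \<in> Obj C"
    and Cod_Obj: "f \<in> Arr C \<Longrightarrow> Cod C f \<in> Obj C"
    and ident_hom: "A \<in> Obj C \<Longrightarrow> ident C A \<in> hom C A A"
    and comp_hom: "f \<in> hom C A B \<Longrightarrow> g \<in> hom C B D \<Longrightarrow> f \<Zcomp> g \<in> hom C A D"
    and otens_Obj: "A \<in> Obj C \<Longrightarrow> B \<in> Obj C \<Longrightarrow> A \<otimes> B \<in> Obj C"
    and Unity_Obj: "Unity C \<in> Obj C"
    and atens_hom: "f \<in> hom C A B \<Longrightarrow> g \<in> hom C A' B' \<Longrightarrow> f \<boxtimes> g \<in> hom C (A \<otimes> A') (B \<otimes> B')"
    and Assoc_hom: "A \<in> Obj C \<Longrightarrow> B \<in> Obj C \<Longrightarrow> D \<in> Obj C \<Longrightarrow>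
      Assoc C A B D \<in> hom C ((A \<otimes> B) \<otimes> D) (A \<otimes> (B \<otimes> D))"
    and Assoc_iso: "A \<in> Obj C \<Longrightarrow> B \<in> Obj C \<Longrightarrow> D \<in> Obj C \<Longrightarrow> is_iso C (Assoc C A B D)"
    and LUnit_hom: "A \<in> Obj C \<Longrightarrow> LUnit C A \<in> hom C (Unity C \<otimes> A) A"
    and LUnit_iso: "A \<in> Obj C \<Longrightarrow> is_iso C (LUnit C A)"
    and RUnit_hom: "A \<in> Obj C \<Longrightarrow> RUnit C A \<in> hom C (A \<otimes> Unity C) A"
    and RUnit_iso: "A \<in> Obj C \<Longrightarrow> is_iso C (RUnit C A)"
    and Symm_hom: "A \<in> Obj C \<Longrightarrow> B \<in> Obj C \<Longrightarrow> Symm C A B \<in> hom C (A \<otimes> B) (B \<otimes> A)"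
begin

lemma typing [simp]:
  "f \<in> Arr C \<Longrightarrow> Dom C f \<in> Obj C"
  "f \<in> Arr C \<Longrightarrow> Cod C f \<in> Obj C"
  "A \<in> Obj C \<Longrightarrow> ident C A \<in> Arr C"
  "A \<in> Obj C \<Longrightarrow> Dom C (ident C A) = A"
  "A \<in> Obj C \<Longrightarrow> Cod C (ident C A) = A"
  "\<lbrakk>f \<in> Arr C; g \<in> Arr C; Cod C f = Dom C g\<rbrakk> \<Longrightarrow> f \<Zcomp> g \<in> Arr C"
  "\<lbrakk>f \<in> Arr C; g \<in> Arr C; Cod C f = Dom C g\<rbrakk> \<Longrightarrow> Dom C (f \<Zcomp> g) = Dom C f"
  "\<lbrakk>f \<in> Arr C; g \<in> Arr C; Cod C f = Dom C g\<rbrakk> \<Longrightarrow> Cod C (f \<Zcomp> g) = Cod C g"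
  "A \<in> Obj C \<Longrightarrow> B \<in> Obj C \<Longrightarrow> A \<otimes> B \<in> Obj C"
  "Unity C \<in> Obj C"
  "f \<in> Arr C \<Longrightarrow> g \<in> Arr C \<Longrightarrow> f \<boxtimes> g \<in> Arr C"
  "f \<in> Arr C \<Longrightarrow> g \<in> Arr C \<Longrightarrow> Dom C (f \<boxtimes> g) = Dom C f \<otimes> Dom C g"
  "f \<in> Arr C \<Longrightarrow> g \<in> Arr C \<Longrightarrow> Cod C (f \<boxtimes> g) = Cod C f \<otimes> Cod C g"
  "\<lbrakk>A \<in> Obj C; B \<in> Obj C; D \<in> Obj C\<rbrakk> \<Longrightarrow> Assoc C A B D \<in> Arr C"
  "\<lbrakk>A \<in> Obj C; B \<in> Obj C; D \<in> Obj C\<rbrakk> \<Longrightarrow> Dom C (Assoc C A B D) = (A \<otimes> B) \<otimes> D"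
  "\<lbrakk>A \<in> Obj C; B \<in> Obj C; D \<in> Obj C\<rbrakk> \<Longrightarrow> Cod C (Assoc C A B D) = A \<otimes> (B \<otimes> D)"
  "A \<in> Obj C \<Longrightarrow> LUnit C A \<in> Arr C"
  "A \<in> Obj C \<Longrightarrow> Dom C (LUnit C A) = Unity C \<otimes> A"
  "A \<in> Obj C \<Longrightarrow> Cod C (LUnit C A) = A"
  "A \<in> Obj C \<Longrightarrow> RUnit C A \<in> Arr C"
  "A \<in> Obj C \<Longrightarrow> Dom C (RUnit C A) = A \<otimes> Unity C"
  "A \<in> Obj C \<Longrightarrow> Cod C (RUnit C A) = A"
  "A \<in> Obj C \<Longrightarrow> B \<in> Obj C \<Longrightarrow> Symm C A B \<in> Arr C"
  "A \<in> Obj C \<Longrightarrow> B \<in> Obj C \<Longrightarrow> Dom C (Symm C A B) = A \<otimes> B"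
  "A \<in> Obj C \<Longrightarrow> B \<in> Obj C \<Longrightarrow> Cod C (Symm C A B) = B \<otimes> A"
  using Dom_Obj Cod_Obj ident_hom[of A] comp_hom[of f "Dom C f" "Cod C f" g "Cod C g"] otens_Obj
    Unity_Obj atens_hom[of f "Dom C f" "Cod C f" g "Dom C g" "Cod C g"] Assoc_hom[of A B D]
    LUnit_hom[of A] RUnit_hom[of A] Symm_hom[of A B]
  by (auto simp: hom_def)

end

text \<open>Makes the rules \<open>typing\<close> available to the simplifier in the target category
  as well.\<close>

sublocale symmetric_monoidal_category \<subseteq> monoidal_signature
  by unfold_locales
    (fact Dom_Obj Cod_Obj ident_hom comp_hom otens_Obj Unity_Obj atens_hom Assoc_hom Assoc_iso
      LUnit_hom LUnit_iso RUnit_hom RUnit_iso Symm_hom)+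

context category
begin

lemma ident_comp [simp]: "f \<in> Arr C \<Longrightarrow> Dom C f = A \<Longrightarrow> ident C A \<Zcomp> f = f"
  using ident_left[of f A "Cod C f"] by (simp add: hom_def)

lemma comp_ident [simp]: "f \<in> Arr C \<Longrightarrow> Cod C f = A \<Longrightarrow> f \<Zcomp> ident C A = f"
  using ident_right[of f "Dom C f" A] by (simp add: hom_def)

lemma is_iso_ident: "A \<in> Obj C \<Longrightarrow> is_iso C (ident C A)"
  using ident_hom[of A] ident_left[of "ident C A" A A]
  by (auto simp: is_iso_def inverse_arrs_def hom_def intro!: exI[of _ "ident C A"])

text \<open>\<open>inv_arr\<close> is a definite description, so evaluating it requires uniqueness
  of two-sided inverses: h = (g f) h = g (f h) = g.\<close>

lemma inv_arr_eqI:
  assumes f: "f \<in> hom C A B" and g: "g \<in> hom C B A"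
    and fg: "f \<Zcomp> g = ident C A" and gf: "g \<Zcomp> f = ident C B"
  shows "inv_arr C f = g"
  unfolding inv_arr_def
proof (rule the_equality)
  show "inverse_arrs C f g"
    using assms by (auto simp: inverse_arrs_def hom_def)
next
  fix h assume h: "inverse_arrs C f h"
  then have h: "h \<in> hom C B A" "f \<Zcomp> h = ident C A"
    using f by (auto simp: inverse_arrs_def hom_def)
  have "h = (g \<Zcomp> f) \<Zcomp> h"
    using h gf ident_left[OF h(1)] by simp
  also have "\<dots> = g"
    using comp_assoc[OF g f h(1)] h(2) ident_right[OF g] by simp
  finally show "h = g" .
qed

end

text \<open>The typing assumptions on \<open>C\<close> make both sides of a monoidal axiom parallel,
  so \<open>faithful\<close> is asked for parallel arrows only, and \<open>OM\<close> may identify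
  objects, as \<open>States\<close> does.\<close>

locale faithful_strict_functor =
  D: symmetric_monoidal_category D + C: monoidal_signature C
  for D :: "('p, 'n) smcat" (structure) and C :: "('o, 'm) smcat" +
  fixes OM :: "'o \<Rightarrow> 'p" and AM :: "'m \<Rightarrow> 'n"
  assumes OM_Obj: "A \<in> Obj C \<Longrightarrow> OM A \<in> Obj D"
    and OM_otens: "A \<in> Obj C \<Longrightarrow> B \<in> Obj C \<Longrightarrow> OM (A \<otimes>\<^bsub>C\<^esub> B) = OM A \<otimes> OM B"
    and OM_Unity: "OM (Unity C) = Unity D"
    and AM_hom: "f \<in> hom C A B \<Longrightarrow> AM f \<in> hom D (OM A) (OM B)"
    and AM_ident: "A \<in> Obj C \<Longrightarrow> AM (ident C A) = ident D (OM A)"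
    and AM_comp: "f \<in> hom C A B \<Longrightarrow> g \<in> hom C B E \<Longrightarrow> AM (f \<Zcomp>\<^bsub>C\<^esub> g) = AM f \<Zcomp> AM g"
    and AM_atens: "f \<in> hom C A B \<Longrightarrow> g \<in> hom C A' B' \<Longrightarrow> AM (f \<boxtimes>\<^bsub>C\<^esub> g) = AM f \<boxtimes> AM g"
    and AM_Assoc: "\<lbrakk>A \<in> Obj C; B \<in> Obj C; E \<in> Obj C\<rbrakk> \<Longrightarrow>
      AM (Assoc C A B E) = Assoc D (OM A) (OM B) (OM E)"
    and AM_LUnit: "A \<in> Obj C \<Longrightarrow> AM (LUnit C A) = LUnit D (OM A)"
    and AM_RUnit: "A \<in> Obj C \<Longrightarrow> AM (RUnit C A) = RUnit D (OM A)"
    and AM_Symm: "A \<in> Obj C \<Longrightarrow> B \<in> Obj C \<Longrightarrow> AM (Symm C A B) = Symm D (OM A) (OM B)"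
    and faithful: "f \<in> hom C A B \<Longrightarrow> g \<in> hom C A B \<Longrightarrow> AM f = AM g \<Longrightarrow> f = g"
begin

lemma AM_typing [simp]:
  "f \<in> Arr C \<Longrightarrow> AM f \<in> Arr D"
  "f \<in> Arr C \<Longrightarrow> Dom D (AM f) = OM (Dom C f)"
  "f \<in> Arr C \<Longrightarrow> Cod D (AM f) = OM (Cod C f)"
  "\<lbrakk>f \<in> Arr C; g \<in> Arr C; Cod C f = Dom C g\<rbrakk> \<Longrightarrow> AM (f \<Zcomp>\<^bsub>C\<^esub> g) = AM f \<Zcomp> AM g"
  "\<lbrakk>f \<in> Arr C; g \<in> Arr C\<rbrakk> \<Longrightarrow> AM (f \<boxtimes>\<^bsub>C\<^esub> g) = AM f \<boxtimes> AM g"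
  using AM_hom[of f "Dom C f" "Cod C f"] AM_comp[of f "Dom C f" "Cod C f" g "Cod C g"]
    AM_atens[of f "Dom C f" "Cod C f" g "Dom C g" "Cod C g"]
  by (auto simp: hom_def)

lemmas AM_simps [simp] =
  OM_Obj OM_otens OM_Unity AM_ident AM_Assoc AM_LUnit AM_RUnit AM_Symm

lemma eqI: "\<lbrakk>f \<in> Arr C; g \<in> Arr C; Dom C f = Dom C g; Cod C f = Cod C g; AM f = AM g\<rbrakk> \<Longrightarrow> f = g"
  using faithful[of f "Dom C f" "Cod C f" g] by (auto simp: hom_def)

lemma homD: "f \<in> hom C A B \<Longrightarrow> f \<in> Arr C \<and> A = Dom C f \<and> B = Cod C f"
  by (auto simp: hom_def)

lemma AM_in_hom: "f \<in> Arr C \<Longrightarrow> AM f \<in> hom D (OM (Dom C f)) (OM (Cod C f))"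
  by (simp add: hom_def)

lemma source_monoidal: "symmetric_monoidal_category C"
proof (unfold_locales, goal_cases)
  \<comment> \<open>Case numbers follow the order of the assumptions of \<open>category\<close> and
    \<open>symmetric_monoidal_category\<close>: 7 is associativity, 11 and 12 functoriality of the
    tensor, 15, 18, 21 and 23 naturality, 24 to 27 the coherence equations.\<close>
  case (7 f A B g B' h E)
  then show ?case
    by (elim homD[THEN conjE] conjE, intro eqI)
      (simp_all add: D.comp_assoc[OF AM_in_hom, of f "AM g" _ "AM h"] hom_def)
next
  case (12 f A B g E f' A' B' g' E')
  then show ?case
    by (elim homD[THEN conjE] conjE, intro eqI)
      (simp_all add: D.atens_comp[OF AM_in_hom, of f "AM g" _ "AM f'" _ _ "AM g'"] hom_def)
next
  case (15 f A A' g B B' h D D')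
  then show ?case
    by (elim homD[THEN conjE] conjE, intro eqI)
      (simp_all add: D.Assoc_nat[OF AM_in_hom AM_in_hom AM_in_hom])
next
  case (18 f A B)
  then show ?case
    using D.LUnit_nat[OF AM_in_hom, of f]
    by (elim homD[THEN conjE] conjE, intro eqI) simp_all
next
  case (21 f A B)
  then show ?case
    using D.RUnit_nat[OF AM_in_hom, of f]
    by (elim homD[THEN conjE] conjE, intro eqI) simp_all
next
  case (23 f A A' g B B')
  then show ?case
    by (elim homD[THEN conjE] conjE, intro eqI)
      (simp_all add: D.Symm_nat[OF AM_in_hom AM_in_hom])
next
  case (24 A B)
  then show ?case by (intro eqI) (simp_all add: D.Symm_Symm)
next
  case (25 A B D E)
  then show ?case by (intro eqI) (simp_all add: D.pentagon)
next
  case (26 A B)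
  then show ?case by (intro eqI) (simp_all add: D.triangle)
next
  case (27 A B D)
  then show ?case by (intro eqI) (simp_all add: D.hexagon)
next
  case (11 A B)
  then show ?case by (intro eqI) (simp_all add: D.atens_ident)
qed (auto simp: hom_def intro: C.Assoc_iso C.LUnit_iso C.RUnit_iso intro!: eqI)

text \<open>With identities as comparison maps, every coherence condition collapses to strict
  preservation of the corresponding structure map.\<close>

lemma symmetric_strong_monoidal:
  "symmetric_strong_monoidal_functor C D
     \<lparr>OMap = OM, AMap = AM, Mult = \<lambda>A B. ident D (OM A \<otimes> OM B), UnitMap = ident D (Unity D)\<rparr>"
proof -
  interpret C': symmetric_monoidal_category C
    by (rule source_monoidal)
  show ?thesis
  proof (unfold_locales, goal_cases)
    case (7 f A A' g B B')
    then show ?case by (auto dest!: homD)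
  qed (simp_all add: AM_hom AM_comp D.is_iso_ident hom_def D.atens_ident)
qed

end

section \<open>Pairs and mutually inverse maps\<close>

lemma Pr_in_pairs [simp]: "Pr a b \<in> pairs A B \<longleftrightarrow> a \<in> A \<and> b \<in> B"
  by (simp add: pairs_def)

lemma in_pairs_iff: "e \<in> pairs A B \<longleftrightarrow> (\<exists>a\<in>A. \<exists>b\<in>B. e = Pr a b)"
  by (auto simp: pairs_def)

lemma ball_pairs [simp]: "(\<forall>e\<in>pairs A B. P e) \<longleftrightarrow> (\<forall>a\<in>A. \<forall>b\<in>B. P (Pr a b))"
  by (auto simp: in_pairs_iff)

lemma Pi_pairs [simp]: "f \<in> pairs A B \<rightarrow> D \<longleftrightarrow> (\<forall>a\<in>A. \<forall>b\<in>B. f (Pr a b) \<in> D)"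
  by (simp add: Pi_iff)

lemma finite_pairs [simp]: "finite A \<Longrightarrow> finite B \<Longrightarrow> finite (pairs A B)"
  by (rule finite_subset[of _ "(\<lambda>(a, b). Pr a b) ` (A \<times> B)"]) (auto simp: pairs_def)

lemma elem_map_simps [simp]:
  "map_pr f g (Pr a b) = Pr (f a) (g b)"
  "assoc_pr (Pr (Pr a b) c) = Pr a (Pr b c)"
  "swap_pr (Pr a b) = Pr b a"
  by (simp_all add: map_pr_def assoc_pr_def swap_pr_def)

definition unassoc_pr :: "'a elem \<Rightarrow> 'a elem" where
  "unassoc_pr e = Pr (Pr (p1 e) (p1 (p2 e))) (p2 (p2 e))"

text \<open>Exchange of the two middle components, its own inverse on quadruples. It is the action
  of \<open>interchange\<close> on elements and also the bijection behind functoriality of the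
  tensor.\<close>

definition mid_pr :: "'a elem \<Rightarrow> 'a elem" where
  "mid_pr e = Pr (Pr (p1 (p1 e)) (p1 (p2 e))) (Pr (p2 (p1 e)) (p2 (p2 e)))"

lemma mid_pr_simp [simp]: "mid_pr (Pr (Pr a b) (Pr c d)) = Pr (Pr a c) (Pr b d)"
  by (simp add: mid_pr_def)

lemma unassoc_pr_simp [simp]: "unassoc_pr (Pr a (Pr b c)) = Pr (Pr a b) c"
  by (simp add: unassoc_pr_def)

text \<open>Naming the inverse lets products and composites of bijections be checked pointwise by
  simplification; \<open>bij_betw\<close> would hide it behind \<open>inv_into\<close>.\<close>

definition inverse_on :: "'b set \<Rightarrow> 'c set \<Rightarrow> ('b \<Rightarrow> 'c) \<Rightarrow> ('c \<Rightarrow> 'b) \<Rightarrow> bool" where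
  "inverse_on A B f g \<longleftrightarrow> (\<forall>a\<in>A. f a \<in> B \<and> g (f a) = a) \<and> (\<forall>b\<in>B. g b \<in> A \<and> f (g b) = b)"

lemma inverse_on_bij_betw: "inverse_on A B f g \<Longrightarrow> bij_betw f A B"
  by (rule bij_betw_byWitness[of _ g]) (auto simp: inverse_on_def)

lemma bij_betw_inverse_on: "bij_betw f A B \<Longrightarrow> inverse_on A B f (inv_into A f)"
  by (auto simp: inverse_on_def bij_betw_def inv_into_into f_inv_into_f)

lemma inverse_on_sym: "inverse_on A B f g \<Longrightarrow> inverse_on B A g f"
  by (auto simp: inverse_on_def)

section \<open>The monoidal category of span automata\<close>

abbreviation fun_aut :: "'a elem set \<Rightarrow> ('a elem \<Rightarrow> 'a elem) \<Rightarrow> 'a span_aut" where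
  "fun_aut A f \<equiv> \<lparr>Trans = A, space = aut_space_unit, Src = \<lambda>_. Point, Tgt = \<lambda>_. Point,
     Llab = id, Rlab = f\<rparr>"

definition aut_class :: "'a elem set \<Rightarrow> 'a elem set \<Rightarrow> 'a span_aut \<Rightarrow> 'a span_aut_class" where
  "aut_class A B x = (A, B, span_aut_iso A B `` {x})"

lemma fun_span_aut_eq: "fun_span_aut A B f = aut_class A B (fun_aut A f)"
  by (simp add: fun_span_aut_def aut_class_def)

lemma aut_space_unit_simps [simp]:
  "States aut_space_unit = {Point}" "Init aut_space_unit = Point" "Finals aut_space_unit = {Point}"
  "aut_space_unit \<in> aut_spaces"
  by (simp_all add: aut_space_unit_def aut_spaces_def)

lemma aut_space_prod_simps [simp]:
  "States (aut_space_prod s t) = pairs (States s) (States t)"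
  "Init (aut_space_prod s t) = Pr (Init s) (Init t)"
  "Finals (aut_space_prod s t) = pairs (Finals s) (Finals t)"
  by (simp_all add: aut_space_prod_def)

lemma aut_space_prod_in_aut_spaces [simp]:
  "s \<in> aut_spaces \<Longrightarrow> t \<in> aut_spaces \<Longrightarrow> aut_space_prod s t \<in> aut_spaces"
  by (auto simp: aut_spaces_def in_pairs_iff subset_iff)

lemma span_aut_comp_in: "x \<in> span_auts A B \<Longrightarrow> y \<in> span_auts B D \<Longrightarrow> span_aut_comp x y \<in> span_auts A D"
  by (auto simp: span_auts_def Pi_iff span_aut_comp_def in_pairs_iff)

lemma span_aut_prod_in:
  "x \<in> span_auts A B \<Longrightarrow> y \<in> span_auts A' B' \<Longrightarrow>
    span_aut_prod x y \<in> span_auts (pairs A A') (pairs B B')"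
  by (auto simp: span_auts_def Pi_iff span_aut_prod_def in_pairs_iff)

lemma fun_aut_in: "finite A \<Longrightarrow> f \<in> A \<rightarrow> B \<Longrightarrow> fun_aut A f \<in> span_auts A B"
  by (auto simp: span_auts_def Pi_iff)

lemma Rlab_update_in: "x \<in> span_auts A B \<Longrightarrow> g \<in> B \<rightarrow> D \<Longrightarrow> x\<lparr>Rlab := g \<circ> Rlab x\<rparr> \<in> span_auts A D"
  by (auto simp: span_auts_def Pi_iff)

lemma Llab_update_in: "x \<in> span_auts A B \<Longrightarrow> g \<in> A \<rightarrow> D \<Longrightarrow> x\<lparr>Llab := g \<circ> Llab x\<rparr> \<in> span_auts D B"
  by (auto simp: span_auts_def Pi_iff)

lemma span_aut_isoI:
  assumes "x \<in> span_auts A B" "y \<in> span_auts A B"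
    and "inverse_on (States (space x)) (States (space y)) \<alpha> \<beta>"
    and "\<alpha> (Init (space x)) = Init (space y)"
    and "\<And>s. s \<in> States (space x) \<Longrightarrow> \<alpha> s \<in> Finals (space y) \<longleftrightarrow> s \<in> Finals (space x)"
    and "inverse_on (Trans x) (Trans y) \<phi> \<psi>"
    and "\<And>e. e \<in> Trans x \<Longrightarrow> Src y (\<phi> e) = \<alpha> (Src x e) \<and> Tgt y (\<phi> e) = \<alpha> (Tgt x e) \<and>
      Llab y (\<phi> e) = Llab x e \<and> Rlab y (\<phi> e) = Rlab x e"
  shows "(x, y) \<in> span_aut_iso A B"
  using assms by (auto simp: span_aut_iso_def dest!: inverse_on_bij_betw)

lemma span_aut_isoE:
  assumes "(x, y) \<in> span_aut_iso A B"
  obtains \<alpha> \<beta> \<phi> \<psi> where "x \<in> span_auts A B" "y \<in> span_auts A B"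
    "inverse_on (States (space x)) (States (space y)) \<alpha> \<beta>"
    "\<alpha> (Init (space x)) = Init (space y)"
    "\<And>s. s \<in> States (space x) \<Longrightarrow> \<alpha> s \<in> Finals (space y) \<longleftrightarrow> s \<in> Finals (space x)"
    "inverse_on (Trans x) (Trans y) \<phi> \<psi>"
    "\<And>e. e \<in> Trans x \<Longrightarrow> Src y (\<phi> e) = \<alpha> (Src x e) \<and> Tgt y (\<phi> e) = \<alpha> (Tgt x e) \<and>
      Llab y (\<phi> e) = Llab x e \<and> Rlab y (\<phi> e) = Rlab x e"
  using assms by (auto simp: span_aut_iso_def dest!: bij_betw_inverse_on)

lemma equiv_span_aut_iso: "equiv (span_auts A B) (span_aut_iso A B)"
proof (rule equivI)
  show "span_aut_iso A B \<subseteq> span_auts A B \<times> span_auts A B"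
    by (auto simp: span_aut_iso_def)
  show "refl_on (span_auts A B) (span_aut_iso A B)"
    by (rule refl_onI)
      (auto intro!: span_aut_isoI[where \<alpha> = id and \<beta> = id and \<phi> = id and \<psi> = id]
        simp: inverse_on_def)
  show "sym (span_aut_iso A B)"
  proof (rule symI)
    fix x y :: "'a span_aut"
    assume "(x, y) \<in> span_aut_iso A B"
    then show "(y, x) \<in> span_aut_iso A B"
    proof (rule span_aut_isoE)
      fix \<alpha> \<beta> \<phi> \<psi>
      assume *: "x \<in> span_auts A B" "y \<in> span_auts A B"
        "inverse_on (States (space x)) (States (space y)) \<alpha> \<beta>"
        "\<alpha> (Init (space x)) = Init (space y)"
        "\<And>s. s \<in> States (space x) \<Longrightarrow> \<alpha> s \<in> Finals (space y) \<longleftrightarrow> s \<in> Finals (space x)"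
        "inverse_on (Trans x) (Trans y) \<phi> \<psi>"
        "\<And>e. e \<in> Trans x \<Longrightarrow> Src y (\<phi> e) = \<alpha> (Src x e) \<and> Tgt y (\<phi> e) = \<alpha> (Tgt x e) \<and>
          Llab y (\<phi> e) = Llab x e \<and> Rlab y (\<phi> e) = Rlab x e"
      have \<psi>: "\<psi> e \<in> Trans x \<and> \<phi> (\<psi> e) = e" if "e \<in> Trans y" for e
        using that *(6) by (auto simp: inverse_on_def)
      \<comment> \<open>\<open>\<beta>\<close> cancels \<open>\<alpha>\<close> only on states, so
        inverting the source and target equations needs to know that sources and targets are
        states.\<close>
      have st: "Src x e \<in> States (space x)" "Tgt x e \<in> States (space x)" "Init (space x) \<in> States (space x)"
        if "e \<in> Trans x" for e
        using *(1) that by (auto simp: span_auts_def Pi_iff aut_spaces_def)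
      show ?thesis
      proof (rule span_aut_isoI)
        show "\<beta> (Init (space y)) = Init (space x)"
          using * by (auto simp: inverse_on_def span_auts_def Pi_iff aut_spaces_def)
        show "\<beta> s \<in> Finals (space x) \<longleftrightarrow> s \<in> Finals (space y)" if "s \<in> States (space y)" for s
          using that *(3) *(5)[of "\<beta> s"] by (auto simp: inverse_on_def)
        show "Src x (\<psi> e) = \<beta> (Src y e) \<and> Tgt x (\<psi> e) = \<beta> (Tgt y e) \<and>
          Llab x (\<psi> e) = Llab y e \<and> Rlab x (\<psi> e) = Rlab y e" if "e \<in> Trans y" for e
          using \<psi>[OF that] *(7)[of "\<psi> e"] st[of "\<psi> e"] *(3) by (auto simp: inverse_on_def)
      qed (use * inverse_on_sym in blast)+
    qed
  qed
  show "trans (span_aut_iso A B)"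
  proof (rule transI)
    fix x y z :: "'a span_aut"
    assume "(x, y) \<in> span_aut_iso A B" and "(y, z) \<in> span_aut_iso A B"
    then show "(x, z) \<in> span_aut_iso A B"
    proof (elim span_aut_isoE)
      fix \<alpha> \<beta> \<phi> \<psi> \<alpha>' \<beta>' \<phi>' \<psi>'
      assume *: "x \<in> span_auts A B" "z \<in> span_auts A B"
        "inverse_on (States (space x)) (States (space y)) \<alpha> \<beta>"
        "\<alpha> (Init (space x)) = Init (space y)"
        "\<And>s. s \<in> States (space x) \<Longrightarrow> \<alpha> s \<in> Finals (space y) \<longleftrightarrow> s \<in> Finals (space x)"
        "inverse_on (Trans x) (Trans y) \<phi> \<psi>"
        "\<And>e. e \<in> Trans x \<Longrightarrow> Src y (\<phi> e) = \<alpha> (Src x e) \<and> Tgt y (\<phi> e) = \<alpha> (Tgt x e) \<and>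
          Llab y (\<phi> e) = Llab x e \<and> Rlab y (\<phi> e) = Rlab x e"
        "inverse_on (States (space y)) (States (space z)) \<alpha>' \<beta>'"
        "\<alpha>' (Init (space y)) = Init (space z)"
        "\<And>s. s \<in> States (space y) \<Longrightarrow> \<alpha>' s \<in> Finals (space z) \<longleftrightarrow> s \<in> Finals (space y)"
        "inverse_on (Trans y) (Trans z) \<phi>' \<psi>'"
        "\<And>e. e \<in> Trans y \<Longrightarrow> Src z (\<phi>' e) = \<alpha>' (Src y e) \<and> Tgt z (\<phi>' e) = \<alpha>' (Tgt y e) \<and>
          Llab z (\<phi>' e) = Llab y e \<and> Rlab z (\<phi>' e) = Rlab y e"
      show ?thesis
        by (rule span_aut_isoI[where \<alpha> = "\<alpha>' \<circ> \<alpha>" and \<beta> = "\<beta> \<circ> \<beta>'" and \<phi> = "\<phi>' \<circ> \<phi>" and \<psi> = "\<psi> \<circ> \<psi>'"])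
          (use * in \<open>auto simp: inverse_on_def Pi_iff\<close>)
    qed
  qed
qed

lemma aut_class_eqI: "(x, y) \<in> span_aut_iso A B \<Longrightarrow> aut_class A B x = aut_class A B y"
  unfolding aut_class_def by (simp add: equiv_class_eq[OF equiv_span_aut_iso])

lemma aut_class_eq_iff:
  "x \<in> span_auts A B \<Longrightarrow> y \<in> span_auts A B \<Longrightarrow>
    aut_class A B x = aut_class A B y \<longleftrightarrow> (x, y) \<in> span_aut_iso A B"
  unfolding aut_class_def by (simp add: eq_equiv_class_iff[OF equiv_span_aut_iso])

lemma span_aut_iso_refl: "x \<in> span_auts A B \<Longrightarrow> (x, x) \<in> span_aut_iso A B"
  using equiv_span_aut_iso by (rule equiv_class_self[THEN ImageE]) auto

section \<open>Composition and product on isomorphism classes\<close>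

lemma span_aut_comp_cong:
  assumes "(x, x') \<in> span_aut_iso A B" "(y, y') \<in> span_aut_iso B D"
  shows "(span_aut_comp x y, span_aut_comp x' y') \<in> span_aut_iso A D"
  using assms
proof (elim span_aut_isoE, goal_cases)
  case (1 \<alpha> \<beta> \<phi> \<psi> \<alpha>' \<beta>' \<phi>' \<psi>')
  \<comment> \<open>The inverse \<open>map_pr \<psi> \<psi>'\<close> has to land in the pullback
    again, so the inverse bijections must preserve the labels on the shared boundary too.\<close>
  have "Rlab x (\<psi> e) = Rlab x' e" if "e \<in> Trans x'" for e
    using that 1(6) 1(7)[of "\<psi> e"] by (auto simp: inverse_on_def)
  moreover have "Llab y (\<psi>' e) = Llab y' e" if "e \<in> Trans y'" for e
    using that 1(13) 1(14)[of "\<psi>' e"] by (auto simp: inverse_on_def)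
  ultimately show ?case
    by (intro span_aut_isoI[where \<alpha> = "map_pr \<alpha> \<alpha>'" and \<beta> = "map_pr \<beta> \<beta>'"
          and \<phi> = "map_pr \<phi> \<phi>'" and \<psi> = "map_pr \<psi> \<psi>'"] span_aut_comp_in)
      (use 1 in \<open>auto simp: inverse_on_def in_pairs_iff span_aut_comp_def\<close>)
qed

lemma span_aut_prod_cong:
  assumes "(x, x') \<in> span_aut_iso A B" "(y, y') \<in> span_aut_iso A' B'"
  shows "(span_aut_prod x y, span_aut_prod x' y') \<in> span_aut_iso (pairs A A') (pairs B B')"
  using assms
proof (elim span_aut_isoE, goal_cases)
  case (1 \<alpha> \<beta> \<phi> \<psi> \<alpha>' \<beta>' \<phi>' \<psi>')
  then show ?case
    by (intro span_aut_isoI[where \<alpha> = "map_pr \<alpha> \<alpha>'" and \<beta> = "map_pr \<beta> \<beta>'"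
          and \<phi> = "map_pr \<phi> \<phi>'" and \<psi> = "map_pr \<psi> \<psi>'"] span_aut_prod_in)
      (auto simp: inverse_on_def in_pairs_iff span_aut_prod_def Pi_iff)
qed

lemma SpanAut_simps [simp]:
  "Obj SpanAut = {A. finite A}"
  "otens SpanAut = pairs"
  "Unity SpanAut = {Point}"
  "ident SpanAut A = fun_span_aut A A id"
  "Assoc SpanAut A B D = fun_span_aut (pairs (pairs A B) D) (pairs A (pairs B D)) assoc_pr"
  "LUnit SpanAut A = fun_span_aut (pairs {Point} A) A p2"
  "RUnit SpanAut A = fun_span_aut (pairs A {Point}) A p1"
  "Symm SpanAut A B = fun_span_aut (pairs A B) (pairs B A) swap_pr"
  by (simp_all add: SpanAut_def)

text \<open>The union in \<open>comp\<close> ranges over all representatives. By congruence all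
  classes united there coincide, so one representative on each side computes the composite.\<close>

lemma SpanAut_comp:
  assumes "x \<in> span_auts A B" "y \<in> span_auts B D"
  shows "aut_class A B x \<Zcomp>\<^bsub>SpanAut\<^esub> aut_class B D y = aut_class A D (span_aut_comp x y)"
proof -
  have "congruent2 (span_aut_iso A B) (span_aut_iso B D)
      (\<lambda>x y. span_aut_iso A D `` {span_aut_comp x y})"
    by (auto intro!: congruent2I' equiv_class_eq[OF equiv_span_aut_iso] span_aut_comp_cong)
  from UN_equiv_class2[OF equiv_span_aut_iso equiv_span_aut_iso this assms]
  show ?thesis by (simp add: SpanAut_def aut_class_def)
qed

lemma SpanAut_atens:
  assumes "x \<in> span_auts A B" "y \<in> span_auts A' B'"
  shows "aut_class A B x \<boxtimes>\<^bsub>SpanAut\<^esub> aut_class A' B' y =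
    aut_class (pairs A A') (pairs B B') (span_aut_prod x y)"
proof -
  have "congruent2 (span_aut_iso A B) (span_aut_iso A' B')
      (\<lambda>x y. span_aut_iso (pairs A A') (pairs B B') `` {span_aut_prod x y})"
    by (auto intro!: congruent2I' equiv_class_eq[OF equiv_span_aut_iso] span_aut_prod_cong)
  from UN_equiv_class2[OF equiv_span_aut_iso equiv_span_aut_iso this assms]
  show ?thesis by (simp add: SpanAut_def aut_class_def)
qed

lemma SpanAut_hom_iff:
  "f \<in> hom SpanAut A B \<longleftrightarrow> finite A \<and> finite B \<and> (\<exists>x\<in>span_auts A B. f = aut_class A B x)"
  by (cases f) (auto simp: hom_def SpanAut_def aut_class_def quotient_def)

lemma aut_class_in_hom:
  "\<lbrakk>finite A; finite B; x \<in> span_auts A B\<rbrakk> \<Longrightarrow> aut_class A B x \<in> hom SpanAut A B"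
  by (auto simp: SpanAut_hom_iff)

text \<open>The function automaton has identity left labels, so a transition e has exactly one
  partner in the pullback, the transition \<open>Rlab x e\<close>. Only the right label
  changes.\<close>

lemma aut_class_comp_fun:
  assumes "x \<in> span_auts A B" "g \<in> B \<rightarrow> D" "finite B"
  shows "aut_class A B x \<Zcomp>\<^bsub>SpanAut\<^esub> fun_span_aut B D g = aut_class A D (x\<lparr>Rlab := g \<circ> Rlab x\<rparr>)"
  unfolding fun_span_aut_eq SpanAut_comp[OF assms(1) fun_aut_in[OF assms(3,2)]]
  by (rule aut_class_eqI, rule span_aut_isoI[where \<alpha> = p1 and \<beta> = "\<lambda>s. Pr s Point"
        and \<phi> = p1 and \<psi> = "\<lambda>e. Pr e (Rlab x e)"])
    (use assms in \<open>auto intro!: span_aut_comp_in fun_aut_in Rlab_update_in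
      simp: inverse_on_def in_pairs_iff span_aut_comp_def\<close>,
     auto simp: span_auts_def Pi_iff)

text \<open>On this side the partners of a transition e form the preimage of \<open>Llab x e\<close>
  under f. Bijectivity makes the partner unique, and f' names it.\<close>

lemma fun_comp_aut_class:
  assumes "inverse_on A A' f f'" "x \<in> span_auts A' B" "finite A"
  shows "fun_span_aut A A' f \<Zcomp>\<^bsub>SpanAut\<^esub> aut_class A' B x = aut_class A B (x\<lparr>Llab := f' \<circ> Llab x\<rparr>)"
proof -
  have f: "fun_aut A f \<in> span_auts A A'"
    using assms by (auto intro: fun_aut_in simp: inverse_on_def)
  show ?thesis
    unfolding fun_span_aut_eq SpanAut_comp[OF f assms(2)]
    by (rule aut_class_eqI, rule span_aut_isoI[where \<alpha> = p2 and \<beta> = "Pr Point"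
          and \<phi> = p2 and \<psi> = "\<lambda>e. Pr (f' (Llab x e)) e"])
      (use assms f in \<open>auto intro!: span_aut_comp_in Llab_update_in
        simp: inverse_on_def in_pairs_iff span_aut_comp_def\<close>,
       auto simp: span_auts_def Pi_iff)
qed

lemma fun_span_aut_comp [simp]:
  "\<lbrakk>finite A; finite B; f \<in> A \<rightarrow> B; g \<in> B \<rightarrow> D\<rbrakk> \<Longrightarrow>
    fun_span_aut A B f \<Zcomp>\<^bsub>SpanAut\<^esub> fun_span_aut B D g = fun_span_aut A D (g \<circ> f)"
  by (simp add: fun_span_aut_eq[of A B] fun_span_aut_eq[of A D] aut_class_comp_fun fun_aut_in)

lemma fun_span_aut_cong:
  assumes "finite A" "f \<in> A \<rightarrow> B" "\<And>a. a \<in> A \<Longrightarrow> f a = g a"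
  shows "fun_span_aut A B f = fun_span_aut A B g"
  unfolding fun_span_aut_eq
  by (rule aut_class_eqI, rule span_aut_isoI[where \<alpha> = id and \<beta> = id and \<phi> = id and \<psi> = id])
    (use assms in \<open>auto intro!: fun_aut_in simp: inverse_on_def Pi_iff\<close>)

lemma fun_span_aut_atens [simp]:
  assumes "finite A" "finite A'" "f \<in> A \<rightarrow> B" "f' \<in> A' \<rightarrow> B'"
  shows "fun_span_aut A B f \<boxtimes>\<^bsub>SpanAut\<^esub> fun_span_aut A' B' f' =
    fun_span_aut (pairs A A') (pairs B B') (map_pr f f')"
  unfolding fun_span_aut_eq SpanAut_atens[OF fun_aut_in[OF assms(1,3)] fun_aut_in[OF assms(2,4)]]
  \<comment> \<open>The product of two one-state spaces has the single state
    \<open>Pr Point Point\<close>, hence the constant state maps.\<close>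
  by (rule aut_class_eqI, rule span_aut_isoI[where \<alpha> = "\<lambda>_. Point" and \<beta> = "\<lambda>_. Pr Point Point"
        and \<phi> = id and \<psi> = id])
    (use assms fun_aut_in[of "pairs A A'" "map_pr f f'" "pairs B B'"]
      span_aut_prod_in[OF fun_aut_in[OF assms(1,3)] fun_aut_in[OF assms(2,4)]]
      in \<open>auto simp: inverse_on_def span_aut_prod_def in_pairs_iff fun_aut_in Pi_iff\<close>)

lemma fun_span_aut_in_hom:
  "\<lbrakk>finite A; finite B; f \<in> A \<rightarrow> B\<rbrakk> \<Longrightarrow> fun_span_aut A B f \<in> hom SpanAut A B"
  by (simp add: fun_span_aut_eq aut_class_in_hom fun_aut_in)

lemma is_iso_fun_span_aut:
  assumes "inverse_on A B f g" "finite A" "finite B"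
  shows "is_iso SpanAut (fun_span_aut A B f)"
proof -
  have "fun_span_aut A B f \<in> hom SpanAut A B" "fun_span_aut B A g \<in> hom SpanAut B A"
    using assms by (auto intro!: fun_span_aut_in_hom simp: inverse_on_def)
  moreover have "fun_span_aut A B f \<Zcomp>\<^bsub>SpanAut\<^esub> fun_span_aut B A g = fun_span_aut A A id"
    "fun_span_aut B A g \<Zcomp>\<^bsub>SpanAut\<^esub> fun_span_aut A B f = fun_span_aut B B id"
    using assms
    by (subst fun_span_aut_comp; auto simp: inverse_on_def intro!: fun_span_aut_cong)+
  ultimately show ?thesis
    by (auto simp: is_iso_def inverse_arrs_def hom_def intro!: exI[of _ "fun_span_aut B A g"]
        simp del: split_paired_Ex)
qed

section \<open>Structure bijections, associativity and naturality\<close>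

lemma inverse_on_structure:
  "inverse_on (pairs (pairs A B) D) (pairs A (pairs B D)) assoc_pr unassoc_pr"
  "inverse_on (pairs {Point} A) A p2 (Pr Point)"
  "inverse_on (pairs A {Point}) A p1 (\<lambda>a. Pr a Point)"
  "inverse_on (pairs A B) (pairs B A) swap_pr swap_pr"
  "inverse_on A A id id"
  by (auto simp: inverse_on_def in_pairs_iff)

lemma SpanAut_comp_assoc:
  assumes "x \<in> span_auts A B" "y \<in> span_auts B D" "z \<in> span_auts D E"
  shows "(span_aut_comp (span_aut_comp x y) z, span_aut_comp x (span_aut_comp y z)) \<in> span_aut_iso A E"
  by (rule span_aut_isoI[where \<alpha> = assoc_pr and \<beta> = unassoc_pr and \<phi> = assoc_pr and \<psi> = unassoc_pr])
    (use assms in \<open>auto intro!: span_aut_comp_in simp: inverse_on_def\<close>,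
     auto simp: span_aut_comp_def in_pairs_iff)

text \<open>Both sides consist of quadruples that differ by the order of the middle components. The
  pullback condition on the right is an equation between pairs and splits into the two conditions on
  the left.\<close>

lemma span_aut_prod_comp:
  assumes "x \<in> span_auts A B" "y \<in> span_auts B D" "x' \<in> span_auts A' B'" "y' \<in> span_auts B' D'"
  shows "(span_aut_prod (span_aut_comp x y) (span_aut_comp x' y'),
      span_aut_comp (span_aut_prod x x') (span_aut_prod y y')) \<in> span_aut_iso (pairs A A') (pairs D D')"
  by (rule span_aut_isoI[where \<alpha> = mid_pr and \<beta> = mid_pr and \<phi> = mid_pr and \<psi> = mid_pr])
    (use assms in \<open>auto intro!: span_aut_comp_in span_aut_prod_in simp: inverse_on_def\<close>,
     auto simp: span_aut_comp_def span_aut_prod_def in_pairs_iff)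

text \<open>Both composites of a naturality square are mere relabellings, one by g on the right and
  one by f' on the left. So naturality of each structure map reduces to one isomorphism of
  automata.\<close>

lemma fun_aut_natural:
  assumes x: "x \<in> span_auts A B" and y: "y \<in> span_auts A' B'" and "finite A" "finite B"
    and g: "g \<in> B \<rightarrow> B'" and f: "inverse_on A A' f f'"
    and iso: "(x\<lparr>Rlab := g \<circ> Rlab x\<rparr>, y\<lparr>Llab := f' \<circ> Llab y\<rparr>) \<in> span_aut_iso A B'"
  shows "aut_class A B x \<Zcomp>\<^bsub>SpanAut\<^esub> fun_span_aut B B' g = fun_span_aut A A' f \<Zcomp>\<^bsub>SpanAut\<^esub> aut_class A' B' y"
  using assms by (simp add: aut_class_comp_fun fun_comp_aut_class aut_class_eqI)

theorem symmetric_monoidal_SpanAut: "symmetric_monoidal_category SpanAut"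
proof (unfold_locales, goal_cases)
  case (1 f)
  then show ?case by (auto simp: SpanAut_def)
next
  case (2 f)
  then show ?case by (auto simp: SpanAut_def)
next
  case (3 A)
  then show ?case by (simp add: fun_span_aut_in_hom)
next
  case (4 f A B g D)
  then show ?case by (auto simp: SpanAut_hom_iff SpanAut_comp intro!: bexI span_aut_comp_in)
next
  case (5 f A B)
  then show ?case
    by (auto simp: SpanAut_hom_iff fun_comp_aut_class[OF inverse_on_structure(5)])
next
  case (6 f A B)
  then show ?case by (auto simp: SpanAut_hom_iff aut_class_comp_fun)
next
  case (7 f A B g D h E)
  then show ?case
    by (auto simp: SpanAut_hom_iff SpanAut_comp span_aut_comp_in intro!: aut_class_eqI SpanAut_comp_assoc)
next
  case (8 A B)
  then show ?case by simp
next
  case 9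
  then show ?case by simp
next
  case (10 f A B g A' B')
  then show ?case by (auto simp: SpanAut_hom_iff SpanAut_atens intro!: bexI span_aut_prod_in)
next
  case (11 A B)
  then show ?case by (auto intro!: fun_span_aut_cong simp: in_pairs_iff)
next
  case (12 f A B g D f' A' B' g' D')
  then show ?case
    by (auto simp: SpanAut_hom_iff SpanAut_comp SpanAut_atens span_aut_comp_in span_aut_prod_in
        intro!: aut_class_eqI span_aut_prod_comp)
next
  case (13 A B D)
  then show ?case by (auto intro!: fun_span_aut_in_hom simp: in_pairs_iff)
next
  case (14 A B D)
  then show ?case by (auto intro!: is_iso_fun_span_aut[OF inverse_on_structure(1)]
        is_iso_fun_span_aut[OF inverse_on_structure(2)] is_iso_fun_span_aut[OF inverse_on_structure(3)])
next
  \<comment> \<open>Naturality of the associator: the same rebracketing serves as the bijection on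
    states and on transitions, and it also relates the labels.\<close>
  case (15 f A A' g B B' h D D')
  then obtain x y z where *: "x \<in> span_auts A A'" "y \<in> span_auts B B'" "z \<in> span_auts D D'"
    and [simp]: "f = aut_class A A' x" "g = aut_class B B' y" "h = aut_class D D' z"
      "finite A" "finite B" "finite D" "finite A'" "finite B'" "finite D'"
    by (auto simp: SpanAut_hom_iff)
  note in_auts = * span_aut_prod_in[OF *(1,2)] span_aut_prod_in[OF *(2,3)]
    span_aut_prod_in[OF span_aut_prod_in[OF *(1,2)] *(3)]
    span_aut_prod_in[OF *(1) span_aut_prod_in[OF *(2,3)]]
  have "(span_aut_prod (span_aut_prod x y) z\<lparr>Rlab := assoc_pr \<circ> Rlab (span_aut_prod (span_aut_prod x y) z)\<rparr>,
     span_aut_prod x (span_aut_prod y z)\<lparr>Llab := unassoc_pr \<circ> Llab (span_aut_prod x (span_aut_prod y z))\<rparr>)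
    \<in> span_aut_iso (pairs (pairs A B) D) (pairs A' (pairs B' D'))"
    by (rule span_aut_isoI[where \<alpha> = assoc_pr and \<beta> = unassoc_pr and \<phi> = assoc_pr and \<psi> = unassoc_pr])
     (auto intro!: Rlab_update_in[OF in_auts(6)] Llab_update_in[OF in_auts(7)] simp: inverse_on_def,
      auto simp: span_aut_prod_def in_pairs_iff)
  then show ?case
    by (auto simp: SpanAut_atens in_pairs_iff in_auts inverse_on_structure
        intro!: fun_aut_natural[where f' = unassoc_pr])
next
  case (16 A)
  then show ?case by (auto intro!: fun_span_aut_in_hom simp: in_pairs_iff)
next
  case (17 A)
  then show ?case by (auto intro!: is_iso_fun_span_aut[OF inverse_on_structure(1)]
        is_iso_fun_span_aut[OF inverse_on_structure(2)] is_iso_fun_span_aut[OF inverse_on_structure(3)])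
next
  \<comment> \<open>Naturality of the left unitor: dropping the component \<open>Point\<close>
    removes the extra state and the extra transition of the identity automaton on the unit.\<close>
  case (18 f A B)
  then obtain x where x: "x \<in> span_auts A B" and [simp]: "f = aut_class A B x" "finite A" "finite B"
    by (auto simp: SpanAut_hom_iff)
  let ?I = "fun_aut {Point} id"
  have I: "?I \<in> span_auts {Point} {Point}" by (simp add: fun_aut_in)
  have Ix: "span_aut_prod ?I x \<in> span_auts (pairs {Point} A) (pairs {Point} B)"
    by (rule span_aut_prod_in[OF I x])
  have "(span_aut_prod ?I x\<lparr>Rlab := p2 \<circ> Rlab (span_aut_prod ?I x)\<rparr>, x\<lparr>Llab := Pr Point \<circ> Llab x\<rparr>)
    \<in> span_aut_iso (pairs {Point} A) B"
    by (rule span_aut_isoI[where \<alpha> = p2 and \<beta> = "Pr Point" and \<phi> = p2 and \<psi> = "Pr Point"])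
     (auto intro!: Rlab_update_in[OF Ix] Llab_update_in[OF x] simp: inverse_on_def,
      auto simp: span_aut_prod_def in_pairs_iff)
  then show ?case
    using x
    by (auto simp: SpanAut_atens in_pairs_iff fun_span_aut_eq[of "{Point}" "{Point}"] I Ix inverse_on_structure
        intro!: fun_aut_natural[where f' = "Pr Point"])
next
  case (19 A)
  then show ?case by (auto intro!: fun_span_aut_in_hom simp: in_pairs_iff)
next
  case (20 A)
  then show ?case by (auto intro!: is_iso_fun_span_aut[OF inverse_on_structure(1)]
        is_iso_fun_span_aut[OF inverse_on_structure(2)] is_iso_fun_span_aut[OF inverse_on_structure(3)])
next
  case (21 f A B)
  then obtain x where x: "x \<in> span_auts A B" and [simp]: "f = aut_class A B x" "finite A" "finite B"
    by (auto simp: SpanAut_hom_iff)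
  let ?I = "fun_aut {Point} id"
  have I: "?I \<in> span_auts {Point} {Point}" by (simp add: fun_aut_in)
  have xI: "span_aut_prod x ?I \<in> span_auts (pairs A {Point}) (pairs B {Point})"
    by (rule span_aut_prod_in[OF x I])
  have "(span_aut_prod x ?I\<lparr>Rlab := p1 \<circ> Rlab (span_aut_prod x ?I)\<rparr>, x\<lparr>Llab := (\<lambda>a. Pr a Point) \<circ> Llab x\<rparr>)
    \<in> span_aut_iso (pairs A {Point}) B"
    by (rule span_aut_isoI[where \<alpha> = p1 and \<beta> = "\<lambda>s. Pr s Point" and \<phi> = p1 and \<psi> = "\<lambda>s. Pr s Point"])
     (auto intro!: Rlab_update_in[OF xI] Llab_update_in[OF x] simp: inverse_on_def,
      auto simp: span_aut_prod_def in_pairs_iff)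
  then show ?case
    using x
    by (auto simp: SpanAut_atens in_pairs_iff fun_span_aut_eq[of "{Point}" "{Point}"] I xI inverse_on_structure
        intro!: fun_aut_natural[where f' = "\<lambda>a. Pr a Point"])
next
  case (22 A B)
  then show ?case by (auto intro!: fun_span_aut_in_hom simp: in_pairs_iff)
next
  case (23 f A A' g B B')
  then obtain x y where *: "x \<in> span_auts A A'" "y \<in> span_auts B B'"
    and [simp]: "f = aut_class A A' x" "g = aut_class B B' y"
      "finite A" "finite B" "finite A'" "finite B'"
    by (auto simp: SpanAut_hom_iff)
  note in_auts = * span_aut_prod_in[OF *] span_aut_prod_in[OF *(2,1)]
  have "(span_aut_prod x y\<lparr>Rlab := swap_pr \<circ> Rlab (span_aut_prod x y)\<rparr>,
     span_aut_prod y x\<lparr>Llab := swap_pr \<circ> Llab (span_aut_prod y x)\<rparr>)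
    \<in> span_aut_iso (pairs A B) (pairs B' A')"
    by (rule span_aut_isoI[where \<alpha> = swap_pr and \<beta> = swap_pr and \<phi> = swap_pr and \<psi> = swap_pr])
     (auto intro!: Rlab_update_in[OF in_auts(3)] Llab_update_in[OF in_auts(4)] simp: inverse_on_def,
      auto simp: span_aut_prod_def in_pairs_iff)
  then show ?case
    by (auto simp: SpanAut_atens in_pairs_iff in_auts inverse_on_structure
        intro!: fun_aut_natural[where f' = swap_pr])
next
  \<comment> \<open>Here and in the remaining coherence axioms both sides simplify to function
    automata, leaving pointwise equality of two rearrangements of tuples.\<close>
  case (24 A B)
  then show ?case by (auto intro!: fun_span_aut_cong simp: in_pairs_iff)
next
  case (25 A B D E)
  then show ?case by (auto intro!: fun_span_aut_cong simp: in_pairs_iff)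
next
  case (26 A B)
  then show ?case by (auto intro!: fun_span_aut_cong simp: in_pairs_iff)
next
  case (27 A B D)
  then show ?case by (auto intro!: fun_span_aut_cong simp: in_pairs_iff)
qed

section \<open>Spans as one-state automata\<close>

text \<open>The single state is that of the monoidal unit, as in \<open>fun_span_aut\<close>, so the
  span of a function is sent exactly to the automaton of that function.\<close>

definition one_state :: "'a span \<Rightarrow> 'a span_aut" where
  "one_state x = \<lparr>Trans = Head x, space = aut_space_unit, Src = \<lambda>_. Point, Tgt = \<lambda>_. Point,
     Llab = Lleg x, Rlab = Rleg x\<rparr>"

lemma one_state_simps [simp]:
  "Trans (one_state x) = Head x" "space (one_state x) = aut_space_unit"
  "Src (one_state x) e = Point" "Tgt (one_state x) e = Point"
  "Llab (one_state x) = Lleg x" "Rlab (one_state x) = Rleg x"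
  by (simp_all add: one_state_def)

lemma one_state_update:
  "one_state (x\<lparr>Rleg := g \<circ> Rleg x\<rparr>) = (one_state x)\<lparr>Rlab := g \<circ> Rlab (one_state x)\<rparr>"
  "one_state (x\<lparr>Lleg := f \<circ> Lleg x\<rparr>) = (one_state x)\<lparr>Llab := f \<circ> Llab (one_state x)\<rparr>"
  "one_state \<lparr>Head = A, Lleg = id, Rleg = f\<rparr> = fun_aut A f"
  by (simp_all add: one_state_def)

definition span_class :: "'a elem set \<Rightarrow> 'a elem set \<Rightarrow> 'a span \<Rightarrow> 'a span_class" where
  "span_class A B x = (A, B, span_iso A B `` {x})"

lemma fun_span_eq: "fun_span A B f = span_class A B \<lparr>Head = A, Lleg = id, Rleg = f\<rparr>"
  by (simp add: fun_span_def span_class_def)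

lemma one_state_in_iff [simp]: "one_state x \<in> span_auts A B \<longleftrightarrow> x \<in> spans A B"
  by (auto simp: spans_def span_auts_def)

text \<open>Labels are the legs and the sources and targets are constant, so the bijection of
  transitions carries all the information. The reflecting direction is what makes the embedding of
  spans faithful.\<close>

lemma one_state_iso_iff: "(one_state x, one_state y) \<in> span_aut_iso A B \<longleftrightarrow> (x, y) \<in> span_iso A B"
proof
  show "(one_state x, one_state y) \<in> span_aut_iso A B" if "(x, y) \<in> span_iso A B"
  proof -
    from that obtain \<phi> where "x \<in> spans A B" "y \<in> spans A B" "bij_betw \<phi> (Head x) (Head y)"
      "\<forall>e\<in>Head x. Lleg y (\<phi> e) = Lleg x e \<and> Rleg y (\<phi> e) = Rleg x e"
      by (auto simp: span_iso_def)
    then show ?thesis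
      by (intro span_aut_isoI[where \<alpha> = id and \<beta> = id and \<phi> = \<phi> and \<psi> = "inv_into (Head x) \<phi>"])
        (auto simp: bij_betw_inverse_on, simp add: inverse_on_def)
  qed
qed (auto simp: span_aut_iso_def span_iso_def)

text \<open>Isomorphism of spans is the pullback of isomorphism of automata along
  \<open>one_state\<close>, so it inherits being an equivalence.\<close>

lemma equiv_span_iso: "equiv (spans A B) (span_iso A B)"
proof (rule equivI)
  show "span_iso A B \<subseteq> spans A B \<times> spans A B"
    by (auto simp: span_iso_def)
  show "refl_on (spans A B) (span_iso A B)"
    by (rule refl_onI) (simp add: one_state_iso_iff[symmetric] span_aut_iso_refl)
  show "sym (span_iso A B)"
    using equiv_span_aut_iso[of A B] unfolding equiv_def
    by (auto intro!: symI simp: one_state_iso_iff[symmetric] dest: symD)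
  show "trans (span_iso A B)"
    using equiv_span_aut_iso[of A B] unfolding equiv_def
    by (auto intro!: transI simp: one_state_iso_iff[symmetric] dest: transD)
qed

text \<open>An isomorphism and not an equality: the composite automaton has the state
  \<open>Pr Point Point\<close> in place of \<open>Point\<close>. The transitions agree
  literally.\<close>

lemma one_state_comp:
  assumes "x \<in> spans A B" "y \<in> spans B D"
  shows "(one_state (span_comp x y), span_aut_comp (one_state x) (one_state y)) \<in> span_aut_iso A D"
proof -
  have "span_comp x y \<in> spans A D"
    using assms by (auto simp: spans_def span_comp_def in_pairs_iff Pi_iff)
  moreover have "span_aut_comp (one_state x) (one_state y) \<in> span_auts A D"
    using assms by (intro span_aut_comp_in[of _ A B]) simp_all
  ultimately show ?thesis
    by (intro span_aut_isoI[where \<alpha> = "\<lambda>_. Pr Point Point" and \<beta> = "\<lambda>_. Point" and \<phi> = id and \<psi> = id])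
      (auto simp: inverse_on_def span_aut_comp_def span_comp_def in_pairs_iff)
qed

lemma one_state_prod:
  assumes "x \<in> spans A B" "y \<in> spans A' B'"
  shows "(one_state (span_prod x y), span_aut_prod (one_state x) (one_state y))
    \<in> span_aut_iso (pairs A A') (pairs B B')"
proof -
  have "span_prod x y \<in> spans (pairs A A') (pairs B B')"
    using assms by (auto simp: spans_def span_prod_def in_pairs_iff Pi_iff)
  moreover have "span_aut_prod (one_state x) (one_state y) \<in> span_auts (pairs A A') (pairs B B')"
    using assms by (intro span_aut_prod_in) simp_all
  ultimately show ?thesis
    by (intro span_aut_isoI[where \<alpha> = "\<lambda>_. Pr Point Point" and \<beta> = "\<lambda>_. Point" and \<phi> = id and \<psi> = id])
      (auto simp: inverse_on_def span_aut_prod_def span_prod_def in_pairs_iff)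
qed

lemma span_comp_in: "x \<in> spans A B \<Longrightarrow> y \<in> spans B D \<Longrightarrow> span_comp x y \<in> spans A D"
  using one_state_comp[of x A B y D] by (simp add: span_aut_iso_def)

lemma span_prod_in:
  "x \<in> spans A B \<Longrightarrow> y \<in> spans A' B' \<Longrightarrow> span_prod x y \<in> spans (pairs A A') (pairs B B')"
  using one_state_prod[of x A B y A' B'] by (simp add: span_aut_iso_def)

lemma span_isoD: "(x, y) \<in> span_iso A B \<Longrightarrow> x \<in> spans A B \<and> y \<in> spans A B"
  by (simp add: span_iso_def)

text \<open>Transported from automata: both composites of spans are isomorphic, as one-state
  automata, to composites that \<open>span_aut_comp_cong\<close> relates.\<close>

lemma span_comp_cong:
  assumes "(x, x') \<in> span_iso A B" "(y, y') \<in> span_iso B D"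
  shows "(span_comp x y, span_comp x' y') \<in> span_iso A D"
proof -
  have "(span_aut_comp (one_state x) (one_state y), span_aut_comp (one_state x') (one_state y'))
      \<in> span_aut_iso A D"
    using assms by (intro span_aut_comp_cong[of _ _ A B]) (simp_all add: one_state_iso_iff)
  then have "aut_class A D (one_state (span_comp x y)) = aut_class A D (one_state (span_comp x' y'))"
    using assms[THEN span_isoD] one_state_comp[THEN aut_class_eqI, of x A B y D]
      one_state_comp[THEN aut_class_eqI, of x' A B y' D] aut_class_eqI by fastforce
  then show ?thesis
    using assms[THEN span_isoD] by (subst (asm) aut_class_eq_iff)
      (auto simp: one_state_iso_iff intro: span_comp_in)
qed

lemma span_prod_cong:
  assumes "(x, x') \<in> span_iso A B" "(y, y') \<in> span_iso A' B'"
  shows "(span_prod x y, span_prod x' y') \<in> span_iso (pairs A A') (pairs B B')"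
proof -
  let ?A = "pairs A A'" and ?B = "pairs B B'"
  have "(span_aut_prod (one_state x) (one_state y), span_aut_prod (one_state x') (one_state y'))
      \<in> span_aut_iso ?A ?B"
    using assms by (intro span_aut_prod_cong) (simp_all add: one_state_iso_iff)
  then have "aut_class ?A ?B (one_state (span_prod x y)) = aut_class ?A ?B (one_state (span_prod x' y'))"
    using assms[THEN span_isoD] one_state_prod[THEN aut_class_eqI, of x A B y A' B']
      one_state_prod[THEN aut_class_eqI, of x' A B y' A' B'] aut_class_eqI by fastforce
  then show ?thesis
    using assms[THEN span_isoD] by (subst (asm) aut_class_eq_iff)
      (auto simp: one_state_iso_iff intro: span_prod_in)
qed

section \<open>Spans on representatives and their embedding into automata\<close>

lemma Span_simps [simp]:
  "Obj Span_FinSet = {A. finite A}"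
  "otens Span_FinSet = pairs"
  "Unity Span_FinSet = {Point}"
  "ident Span_FinSet A = fun_span A A id"
  "Assoc Span_FinSet A B D = fun_span (pairs (pairs A B) D) (pairs A (pairs B D)) assoc_pr"
  "LUnit Span_FinSet A = fun_span (pairs {Point} A) A p2"
  "RUnit Span_FinSet A = fun_span (pairs A {Point}) A p1"
  "Symm Span_FinSet A B = fun_span (pairs A B) (pairs B A) swap_pr"
  by (simp_all add: Span_FinSet_def)

lemma Span_comp:
  assumes "x \<in> spans A B" "y \<in> spans B D"
  shows "span_class A B x \<Zcomp>\<^bsub>Span_FinSet\<^esub> span_class B D y = span_class A D (span_comp x y)"
proof -
  have "congruent2 (span_iso A B) (span_iso B D) (\<lambda>x y. span_iso A D `` {span_comp x y})"
    by (auto intro!: congruent2I' equiv_class_eq[OF equiv_span_iso] span_comp_cong)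
  from UN_equiv_class2[OF equiv_span_iso equiv_span_iso this assms]
  show ?thesis by (simp add: Span_FinSet_def span_class_def)
qed

lemma Span_atens:
  assumes "x \<in> spans A B" "y \<in> spans A' B'"
  shows "span_class A B x \<boxtimes>\<^bsub>Span_FinSet\<^esub> span_class A' B' y =
    span_class (pairs A A') (pairs B B') (span_prod x y)"
proof -
  have "congruent2 (span_iso A B) (span_iso A' B')
      (\<lambda>x y. span_iso (pairs A A') (pairs B B') `` {span_prod x y})"
    by (auto intro!: congruent2I' equiv_class_eq[OF equiv_span_iso] span_prod_cong)
  from UN_equiv_class2[OF equiv_span_iso equiv_span_iso this assms]
  show ?thesis by (simp add: Span_FinSet_def span_class_def)
qed

lemma Span_hom_iff:
  "f \<in> hom Span_FinSet A B \<longleftrightarrow> finite A \<and> finite B \<and> (\<exists>x\<in>spans A B. f = span_class A B x)"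
  by (cases f) (auto simp: hom_def Span_FinSet_def span_class_def quotient_def)

lemma span_class_in_hom:
  "\<lbrakk>finite A; finite B; x \<in> spans A B\<rbrakk> \<Longrightarrow> span_class A B x \<in> hom Span_FinSet A B"
  by (auto simp: Span_hom_iff)

lemma span_class_eq_iff:
  "x \<in> spans A B \<Longrightarrow> y \<in> spans A B \<Longrightarrow> span_class A B x = span_class A B y \<longleftrightarrow> (x, y) \<in> span_iso A B"
  unfolding span_class_def by (simp add: eq_equiv_class_iff[OF equiv_span_iso])

lemma span_class_eqI: "(x, y) \<in> span_iso A B \<Longrightarrow> span_class A B x = span_class A B y"
  unfolding span_class_def by (simp add: equiv_class_eq[OF equiv_span_iso])

definition one_state_class :: "'a span_class \<Rightarrow> 'a span_aut_class" where
  "one_state_class = (\<lambda>(A, B, X). (A, B, \<Union>x\<in>X. span_aut_iso A B `` {one_state x}))"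

lemma one_state_class: "x \<in> spans A B \<Longrightarrow> one_state_class (span_class A B x) = aut_class A B (one_state x)"
proof -
  assume x: "x \<in> spans A B"
  have "(\<lambda>x. span_aut_iso A B `` {one_state x}) respects span_iso A B"
    by (auto intro!: congruentI equiv_class_eq[OF equiv_span_aut_iso] simp: one_state_iso_iff)
  from UN_equiv_class[OF equiv_span_iso this x] show ?thesis
    by (simp add: one_state_class_def span_class_def aut_class_def)
qed

lemma one_state_class_inject:
  "\<lbrakk>f \<in> hom Span_FinSet A B; g \<in> hom Span_FinSet A B; one_state_class f = one_state_class g\<rbrakk> \<Longrightarrow> f = g"
  by (auto simp: Span_hom_iff one_state_class aut_class_eq_iff span_class_eq_iff one_state_iso_iff)

lemma one_state_class_comp:
  "f \<in> hom Span_FinSet A B \<Longrightarrow> g \<in> hom Span_FinSet B D \<Longrightarrow>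
    one_state_class (f \<Zcomp>\<^bsub>Span_FinSet\<^esub> g) = one_state_class f \<Zcomp>\<^bsub>SpanAut\<^esub> one_state_class g"
  by (auto simp: Span_hom_iff one_state_class Span_comp SpanAut_comp span_comp_in
      intro!: aut_class_eqI one_state_comp)

lemma one_state_class_atens:
  "f \<in> hom Span_FinSet A B \<Longrightarrow> g \<in> hom Span_FinSet A' B' \<Longrightarrow>
    one_state_class (f \<boxtimes>\<^bsub>Span_FinSet\<^esub> g) = one_state_class f \<boxtimes>\<^bsub>SpanAut\<^esub> one_state_class g"
  by (auto simp: Span_hom_iff one_state_class Span_atens SpanAut_atens span_prod_in
      intro!: aut_class_eqI one_state_prod)

lemma fun_in_spans: "finite A \<Longrightarrow> f \<in> A \<rightarrow> B \<Longrightarrow> \<lparr>Head = A, Lleg = id, Rleg = f\<rparr> \<in> spans A B"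
  by (auto simp: spans_def)

lemma fun_span_in_hom: "\<lbrakk>finite A; finite B; f \<in> A \<rightarrow> B\<rbrakk> \<Longrightarrow> fun_span A B f \<in> hom Span_FinSet A B"
  by (simp add: fun_span_eq span_class_in_hom fun_in_spans)

lemma one_state_class_fun:
  "finite A \<Longrightarrow> f \<in> A \<rightarrow> B \<Longrightarrow> one_state_class (fun_span A B f) = fun_span_aut A B f"
  by (simp add: fun_span_eq fun_span_aut_eq one_state_class fun_in_spans one_state_update)

lemma Span_comp_hom:
  "f \<in> hom Span_FinSet A B \<Longrightarrow> g \<in> hom Span_FinSet B D \<Longrightarrow> f \<Zcomp>\<^bsub>Span_FinSet\<^esub> g \<in> hom Span_FinSet A D"
  by (auto simp: Span_hom_iff Span_comp intro!: bexI span_comp_in)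

lemma Span_atens_hom:
  "f \<in> hom Span_FinSet A B \<Longrightarrow> g \<in> hom Span_FinSet A' B' \<Longrightarrow>
    f \<boxtimes>\<^bsub>Span_FinSet\<^esub> g \<in> hom Span_FinSet (pairs A A') (pairs B B')"
  by (auto simp: Span_hom_iff Span_atens intro!: bexI span_prod_in)

section \<open>Composing and tensoring with spans of functions\<close>

lemma Rleg_update_in: "x \<in> spans A B \<Longrightarrow> g \<in> B \<rightarrow> D \<Longrightarrow> x\<lparr>Rleg := g \<circ> Rleg x\<rparr> \<in> spans A D"
  by (auto simp: spans_def Pi_iff)

lemma Lleg_update_in: "x \<in> spans A B \<Longrightarrow> g \<in> A \<rightarrow> D \<Longrightarrow> x\<lparr>Lleg := g \<circ> Lleg x\<rparr> \<in> spans D B"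
  by (auto simp: spans_def Pi_iff)

text \<open>Faithfulness of the embedding turns this into \<open>aut_class_comp_fun\<close>, which
  avoids a second pullback computation.\<close>

lemma span_class_comp_fun:
  assumes "x \<in> spans A B" "g \<in> B \<rightarrow> D" "finite A" "finite B" "finite D"
  shows "span_class A B x \<Zcomp>\<^bsub>Span_FinSet\<^esub> fun_span B D g = span_class A D (x\<lparr>Rleg := g \<circ> Rleg x\<rparr>)"
proof (rule one_state_class_inject[of _ A D])
  have x: "span_class A B x \<in> hom Span_FinSet A B" and g: "fun_span B D g \<in> hom Span_FinSet B D"
    using assms by (auto intro: span_class_in_hom fun_span_in_hom)
  show "span_class A B x \<Zcomp>\<^bsub>Span_FinSet\<^esub> fun_span B D g \<in> hom Span_FinSet A D"
    by (rule Span_comp_hom[OF x g])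
  show "one_state_class (span_class A B x \<Zcomp>\<^bsub>Span_FinSet\<^esub> fun_span B D g) =
      one_state_class (span_class A D (x\<lparr>Rleg := g \<circ> Rleg x\<rparr>))"
    unfolding one_state_class_comp[OF x g]
    using assms by (simp add: one_state_class one_state_class_fun aut_class_comp_fun Rleg_update_in one_state_update)
qed (use assms in \<open>auto intro!: span_class_in_hom Rleg_update_in\<close>)

lemma fun_comp_span_class:
  assumes "inverse_on A A' f f'" "x \<in> spans A' B" "finite A" "finite A'" "finite B"
  shows "fun_span A A' f \<Zcomp>\<^bsub>Span_FinSet\<^esub> span_class A' B x = span_class A B (x\<lparr>Lleg := f' \<circ> Lleg x\<rparr>)"
proof (rule one_state_class_inject[of _ A B])
  have ff: "f \<in> A \<rightarrow> A'" "f' \<in> A' \<rightarrow> A" using assms(1) by (auto simp: inverse_on_def)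
  have x: "span_class A' B x \<in> hom Span_FinSet A' B" and f: "fun_span A A' f \<in> hom Span_FinSet A A'"
    using assms ff by (auto intro: span_class_in_hom fun_span_in_hom)
  show "fun_span A A' f \<Zcomp>\<^bsub>Span_FinSet\<^esub> span_class A' B x \<in> hom Span_FinSet A B"
    by (rule Span_comp_hom[OF f x])
  show "one_state_class (fun_span A A' f \<Zcomp>\<^bsub>Span_FinSet\<^esub> span_class A' B x) =
      one_state_class (span_class A B (x\<lparr>Lleg := f' \<circ> Lleg x\<rparr>))"
    unfolding one_state_class_comp[OF f x]
    using assms ff by (simp add: one_state_class one_state_class_fun fun_comp_aut_class Lleg_update_in one_state_update)
  show "span_class A B (x\<lparr>Lleg := f' \<circ> Lleg x\<rparr>) \<in> hom Span_FinSet A B"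
    using assms ff by (auto intro!: span_class_in_hom Lleg_update_in)
qed

lemma fun_span_comp [simp]:
  "\<lbrakk>finite A; finite B; finite D; f \<in> A \<rightarrow> B; g \<in> B \<rightarrow> D\<rbrakk> \<Longrightarrow>
    fun_span A B f \<Zcomp>\<^bsub>Span_FinSet\<^esub> fun_span B D g = fun_span A D (g \<circ> f)"
  by (simp add: fun_span_eq[of A B] fun_span_eq[of A D] span_class_comp_fun fun_in_spans)

text \<open>An isomorphism of such spans commutes with identity left legs and is therefore the
  identity, so the class determines the function on A. Faithfulness of \<open>U_AutSpan\<close>
  rests on this.\<close>

lemma fun_span_eq_iff:
  assumes "finite A" "finite B" "f \<in> A \<rightarrow> B" "g \<in> A \<rightarrow> B"
  shows "fun_span A B f = fun_span A B g \<longleftrightarrow> (\<forall>a\<in>A. f a = g a)"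
  using assms
  by (auto simp: fun_span_eq span_class_eq_iff fun_in_spans span_iso_def intro!: exI[of _ id])

lemma fun_span_cong:
  assumes "finite A" "f \<in> A \<rightarrow> B" "\<And>a. a \<in> A \<Longrightarrow> f a = g a"
  shows "fun_span A B f = fun_span A B g"
  using assms unfolding fun_span_eq
  by (intro span_class_eqI) (auto simp: span_iso_def spans_def Pi_iff intro!: exI[of _ id])

lemma fun_span_atens [simp]:
  assumes "finite A" "finite A'" "finite B" "finite B'" "f \<in> A \<rightarrow> B" "f' \<in> A' \<rightarrow> B'"
  shows "fun_span A B f \<boxtimes>\<^bsub>Span_FinSet\<^esub> fun_span A' B' f' =
    fun_span (pairs A A') (pairs B B') (map_pr f f')"
proof (rule one_state_class_inject[of _ "pairs A A'" "pairs B B'"])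
  have f: "fun_span A B f \<in> hom Span_FinSet A B" "fun_span A' B' f' \<in> hom Span_FinSet A' B'"
    using assms by (auto intro: fun_span_in_hom)
  show "fun_span A B f \<boxtimes>\<^bsub>Span_FinSet\<^esub> fun_span A' B' f' \<in> hom Span_FinSet (pairs A A') (pairs B B')"
    by (rule Span_atens_hom[OF f])
  have m: "map_pr f f' \<in> pairs A A' \<rightarrow> pairs B B'"
    using assms by (auto simp: Pi_iff)
  show "one_state_class (fun_span A B f \<boxtimes>\<^bsub>Span_FinSet\<^esub> fun_span A' B' f') =
      one_state_class (fun_span (pairs A A') (pairs B B') (map_pr f f'))"
    unfolding one_state_class_atens[OF f] using assms m by (simp add: one_state_class_fun)
  show "fun_span (pairs A A') (pairs B B') (map_pr f f') \<in> hom Span_FinSet (pairs A A') (pairs B B')"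
    using assms m by (intro fun_span_in_hom) auto
qed

lemma fun_span_inverse:
  assumes "inverse_on A B f g" "finite A" "finite B"
  shows "fun_span A B f \<in> hom Span_FinSet A B" "fun_span B A g \<in> hom Span_FinSet B A"
    "fun_span A B f \<Zcomp>\<^bsub>Span_FinSet\<^esub> fun_span B A g = ident Span_FinSet A"
    "fun_span B A g \<Zcomp>\<^bsub>Span_FinSet\<^esub> fun_span A B f = ident Span_FinSet B"
  using assms
  by (auto simp: inverse_on_def Pi_iff intro!: fun_span_in_hom fun_span_cong)

lemma is_iso_fun_span:
  assumes "inverse_on A B f g" "finite A" "finite B"
  shows "is_iso Span_FinSet (fun_span A B f)"
  using fun_span_inverse[OF assms]
  by (auto simp: is_iso_def inverse_arrs_def hom_def intro!: exI[of _ "fun_span B A g"]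
      simp del: split_paired_Ex)

lemma faithful_one_state:
  "faithful_strict_functor SpanAut Span_FinSet (\<lambda>A. A) one_state_class"
proof -
  interpret symmetric_monoidal_category "SpanAut :: ('a elem set, 'a span_aut_class) smcat"
    by (rule symmetric_monoidal_SpanAut)
  show ?thesis
  proof (unfold_locales, goal_cases)
    \<comment> \<open>Goals 1 to 14 belong to \<open>monoidal_signature\<close>. Of the functor
      axioms, 18 is typing, 20 composition, 21 tensor and 26 faithfulness.\<close>
    case (3 A)
    then show ?case by (simp add: fun_span_in_hom)
  next
    case (18 f A B)
    then show ?case by (auto simp: Span_hom_iff one_state_class intro!: aut_class_in_hom)
  next
    case (4 f A B g D)
    then show ?case by (rule Span_comp_hom)
  next
    case (20 f A B g E)
    then show ?case by (rule one_state_class_comp)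
  next
    case (21 f A B g A' B')
    then show ?case by (rule one_state_class_atens)
  next
    case (26 f A B g)
    then show ?case by (rule one_state_class_inject)
  next
    case (7 f A B g A' B')
    then show ?case by (simp add: Span_atens_hom)
  qed (auto simp: Span_FinSet_def[THEN arg_cong[where f = Arr]] Span_FinSet_def[THEN arg_cong[where f = Dom]]
      Span_FinSet_def[THEN arg_cong[where f = Cod]] one_state_class_fun
      in_pairs_iff
      intro!: fun_span_in_hom is_iso_fun_span[OF inverse_on_structure(1)]
        is_iso_fun_span[OF inverse_on_structure(2)] is_iso_fun_span[OF inverse_on_structure(3)])
qed

theorem symmetric_monoidal_Span_FinSet: "symmetric_monoidal_category Span_FinSet"
  using faithful_strict_functor.source_monoidal[OF faithful_one_state] .

section \<open>State spaces and their underlying sets\<close>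

text \<open>The inverse is carried as a bare function, so that composites and products of
  isomorphisms come with explicit inverses. That it preserves initial and final states is a
  consequence.\<close>

definition aut_iso :: "'a aut_space \<Rightarrow> 'a aut_space \<Rightarrow> ('a elem \<Rightarrow> 'a elem) \<Rightarrow> ('a elem \<Rightarrow> 'a elem) \<Rightarrow> bool" where
  "aut_iso s t \<alpha> \<beta> \<longleftrightarrow> s \<in> aut_spaces \<and> t \<in> aut_spaces \<and> inverse_on (States s) (States t) \<alpha> \<beta> \<and>
     \<alpha> (Init s) = Init t \<and> (\<forall>x\<in>States s. \<alpha> x \<in> Finals t \<longleftrightarrow> x \<in> Finals s)"

lemma aut_spacesD [simp]:
  "s \<in> aut_spaces \<Longrightarrow> Init s \<in> States s"
  "s \<in> aut_spaces \<Longrightarrow> finite (States s)"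
  by (simp_all add: aut_spaces_def)

text \<open>Finality is both preserved and reflected, so evaluating the equivalence at
  \<open>\<beta> x\<close> gives it for the inverse; the initial state follows by cancelling
  \<open>\<alpha>\<close>.\<close>

lemma aut_iso_inverse:
  assumes "aut_iso s t \<alpha> \<beta>"
  shows "aut_iso t s \<beta> \<alpha>"
proof -
  have *: "\<forall>x\<in>States s. \<alpha> x \<in> States t \<and> \<beta> (\<alpha> x) = x" "\<forall>x\<in>States t. \<beta> x \<in> States s \<and> \<alpha> (\<beta> x) = x"
    "\<forall>x\<in>States s. \<alpha> x \<in> Finals t \<longleftrightarrow> x \<in> Finals s" "\<alpha> (Init s) = Init t" "Init s \<in> States s"
    using assms by (simp_all add: aut_iso_def inverse_on_def)
  have "\<beta> x \<in> Finals s \<longleftrightarrow> x \<in> Finals t" if "x \<in> States t" for x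
    using *(2) *(3)[rule_format, of "\<beta> x"] that by simp
  moreover have "\<beta> (Init t) = Init s"
    using *(1)[rule_format, of "Init s"] *(4,5) by simp
  ultimately show ?thesis
    using assms by (simp add: aut_iso_def inverse_on_sym)
qed

lemma aut_iso_ident: "s \<in> aut_spaces \<Longrightarrow> aut_iso s s id id"
  by (simp add: aut_iso_def inverse_on_structure)

lemma aut_iso_comp:
  "aut_iso s t \<alpha> \<beta> \<Longrightarrow> aut_iso t u \<alpha>' \<beta>' \<Longrightarrow> aut_iso s u (\<alpha>' \<circ> \<alpha>) (\<beta> \<circ> \<beta>')"
  by (auto simp: aut_iso_def inverse_on_def)

lemma aut_iso_prod:
  "aut_iso s t \<alpha> \<beta> \<Longrightarrow> aut_iso s' t' \<alpha>' \<beta>' \<Longrightarrow>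
    aut_iso (aut_space_prod s s') (aut_space_prod t t') (map_pr \<alpha> \<alpha>') (map_pr \<beta> \<beta>')"
  by (auto simp: aut_iso_def inverse_on_def in_pairs_iff)

lemma aut_iso_structure:
  assumes "s \<in> aut_spaces" "t \<in> aut_spaces" "u \<in> aut_spaces"
  shows "aut_iso (aut_space_prod (aut_space_prod s t) u) (aut_space_prod s (aut_space_prod t u))
      assoc_pr unassoc_pr"
    and "aut_iso (aut_space_prod aut_space_unit s) s p2 (Pr Point)"
    and "aut_iso (aut_space_prod s aut_space_unit) s p1 (\<lambda>x. Pr x Point)"
    and "aut_iso (aut_space_prod s t) (aut_space_prod t s) swap_pr swap_pr"
  using assms by (auto simp: aut_iso_def inverse_on_structure in_pairs_iff)

lemma aut_map_eq_iff: "aut_map s t \<alpha> = aut_map s t \<beta> \<longleftrightarrow> (\<forall>x\<in>States s. \<alpha> x = \<beta> x)"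
  by (auto simp: aut_map_def fun_eq_iff restrict_def)

lemma aut_map_in_Arr: "aut_iso s t \<alpha> \<beta> \<Longrightarrow> aut_map s t \<alpha> \<in> Arr AutSt"
  by (auto simp: AutSt_def aut_map_def aut_iso_def inverse_on_def)

lemma AutSt_comp:
  "(\<And>x. x \<in> States s \<Longrightarrow> \<alpha> x \<in> States t) \<Longrightarrow>
    aut_map s t \<alpha> \<Zcomp>\<^bsub>AutSt\<^esub> aut_map t u \<beta> = aut_map s u (\<beta> \<circ> \<alpha>)"
  by (auto simp: AutSt_def aut_map_def restrict_def fun_eq_iff)

lemma aut_iso_AutSt_comp:
  "aut_iso s t \<alpha> \<beta> \<Longrightarrow> aut_map s t \<alpha> \<Zcomp>\<^bsub>AutSt\<^esub> aut_map t u \<gamma> = aut_map s u (\<gamma> \<circ> \<alpha>)"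
  by (simp add: aut_iso_def inverse_on_def AutSt_comp)

lemma AutSt_atens:
  "aut_map s t \<alpha> \<boxtimes>\<^bsub>AutSt\<^esub> aut_map s' t' \<alpha>' =
    aut_map (aut_space_prod s s') (aut_space_prod t t') (map_pr \<alpha> \<alpha>')"
  by (auto simp: AutSt_def aut_map_def restrict_def fun_eq_iff in_pairs_iff)

lemma Dom_Cod_aut_map [simp]: "Dom AutSt (aut_map s t \<alpha>) = s" "Cod AutSt (aut_map s t \<alpha>) = t"
  by (simp_all add: AutSt_def aut_map_def)

lemma ident_AutSt: "ident AutSt s = aut_map s s id"
  by (simp add: AutSt_def)

lemma inverse_arrs_aut_map:
  assumes "aut_iso s t \<alpha> \<beta>"
  shows "inverse_arrs AutSt (aut_map s t \<alpha>) (aut_map t s \<beta>)"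
proof -
  have "aut_map s t \<alpha> \<Zcomp>\<^bsub>AutSt\<^esub> aut_map t s \<beta> = aut_map s s id"
    "aut_map t s \<beta> \<Zcomp>\<^bsub>AutSt\<^esub> aut_map s t \<alpha> = aut_map t t id"
    using assms by (simp_all add: aut_iso_def inverse_on_def AutSt_comp aut_map_eq_iff)
  then show ?thesis
    using aut_map_in_Arr[OF aut_iso_inverse[OF assms]]
    by (simp add: inverse_arrs_def hom_def ident_AutSt)
qed

lemma Iso_simps [simp]:
  "Obj (Iso AutSt) = aut_spaces"
  "Dom (Iso AutSt) = Dom AutSt" "Cod (Iso AutSt) = Cod AutSt"
  "comp (Iso AutSt) = comp AutSt"
  "otens (Iso AutSt) = aut_space_prod"
  "atens (Iso AutSt) = atens AutSt"
  "Unity (Iso AutSt) = aut_space_unit"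
  "ident (Iso AutSt) s = aut_map s s id"
  "Assoc (Iso AutSt) s t u = aut_map (aut_space_prod (aut_space_prod s t) u)
       (aut_space_prod s (aut_space_prod t u)) assoc_pr"
  "LUnit (Iso AutSt) s = aut_map (aut_space_prod aut_space_unit s) s p2"
  "RUnit (Iso AutSt) s = aut_map (aut_space_prod s aut_space_unit) s p1"
  "Symm (Iso AutSt) s t = aut_map (aut_space_prod s t) (aut_space_prod t s) swap_pr"
  by (simp_all add: Iso_def AutSt_def)

text \<open>Replaces the existential inverse in \<open>is_iso\<close> by a pair of functions: an
  inverse arrow supplies \<open>\<beta>\<close>, and the two composite equations are read pointwise
  on states.\<close>

lemma hom_Iso_iff: "f \<in> hom (Iso AutSt) s t \<longleftrightarrow> (\<exists>\<alpha> \<beta>. aut_iso s t \<alpha> \<beta> \<and> f = aut_map s t \<alpha>)"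
proof
  assume f: "f \<in> hom (Iso AutSt) s t"
  then obtain \<alpha> where \<alpha>: "f = (s, t, \<alpha>)" "(s, t, \<alpha>) \<in> Arr AutSt" "is_iso AutSt (s, t, \<alpha>)"
    by (cases f) (auto simp: hom_def Iso_def AutSt_def)
  then obtain g where "inverse_arrs AutSt (s, t, \<alpha>) g"
    by (auto simp: is_iso_def)
  then obtain \<beta> where "\<beta> \<in> States t \<rightarrow>\<^sub>E States s"
    and *: "aut_map s s (\<beta> \<circ> \<alpha>) = aut_map s s id" "aut_map t t (\<alpha> \<circ> \<beta>) = aut_map t t id"
    by (cases g) (auto simp: inverse_arrs_def hom_def AutSt_def)
  then have "aut_iso s t \<alpha> \<beta>"
    using \<alpha> unfolding aut_map_eq_iff
    by (auto simp: aut_iso_def AutSt_def inverse_on_def PiE_iff)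
  moreover have "f = aut_map s t \<alpha>"
    using \<alpha> by (auto simp: AutSt_def aut_map_def PiE_iff extensional_restrict)
  ultimately show "\<exists>\<alpha> \<beta>. aut_iso s t \<alpha> \<beta> \<and> f = aut_map s t \<alpha>" by blast
next
  assume "\<exists>\<alpha> \<beta>. aut_iso s t \<alpha> \<beta> \<and> f = aut_map s t \<alpha>"
  then obtain \<alpha> \<beta> where iso: "aut_iso s t \<alpha> \<beta>" and f: "f = aut_map s t \<alpha>" by blast
  have "f \<in> Arr AutSt" "is_iso AutSt f"
    unfolding f is_iso_def using aut_map_in_Arr[OF iso] inverse_arrs_aut_map[OF iso]
    by (simp_all del: split_paired_Ex add: exI)
  then show "f \<in> hom (Iso AutSt) s t"
    by (simp add: hom_def f) (simp add: Iso_def)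
qed

lemma aut_map_in_hom_Iso: "aut_iso s t \<alpha> \<beta> \<Longrightarrow> aut_map s t \<alpha> \<in> hom (Iso AutSt) s t"
  by (auto simp: hom_Iso_iff)

text \<open>The inverse has to lie in the subcategory itself, which holds because it is again an
  isomorphism by \<open>aut_iso_inverse\<close>.\<close>

lemma is_iso_Iso:
  assumes "aut_iso s t \<alpha> \<beta>"
  shows "is_iso (Iso AutSt) (aut_map s t \<alpha>)"
proof -
  have "inverse_arrs (Iso AutSt) (aut_map s t \<alpha>) (aut_map t s \<beta>)"
    using inverse_arrs_aut_map[OF assms] aut_map_in_hom_Iso[OF aut_iso_inverse[OF assms]]
    by (simp add: inverse_arrs_def ident_AutSt)
  then show ?thesis
    using aut_map_in_hom_Iso[OF assms] by (simp del: split_paired_Ex add: is_iso_def hom_def exI)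
qed

text \<open>\<open>aut_map\<close> restricts \<open>\<alpha>\<close> to the states, which changes
  the function but not the class of its span.\<close>

lemma AMap_U: "aut_iso s t \<alpha> \<beta> \<Longrightarrow> AMap U_AutSpan (aut_map s t \<alpha>) = fun_span (States s) (States t) \<alpha>"
  by (auto simp: U_AutSpan_def aut_map_def aut_iso_def inverse_on_def intro!: fun_span_cong)

lemma OMap_U [simp]: "OMap U_AutSpan = States"
  by (simp add: U_AutSpan_def)

lemma aut_iso_funcset: "aut_iso s t \<alpha> \<beta> \<Longrightarrow> \<alpha> \<in> States s \<rightarrow> States t"
  by (auto simp: aut_iso_def inverse_on_def)

lemma aut_iso_in: "aut_iso s t \<alpha> \<beta> \<Longrightarrow> s \<in> aut_spaces \<and> t \<in> aut_spaces"
  by (simp add: aut_iso_def)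

text \<open>\<open>States\<close> forgets initial and final states, yet parallel arrows are still
  determined by their functions, and \<open>fun_span_eq_iff\<close> recovers these from the
  spans.\<close>

lemma faithful_U_AutSpan:
  "faithful_strict_functor Span_FinSet (Iso AutSt) States (AMap U_AutSpan)"
proof -
  interpret symmetric_monoidal_category "Span_FinSet :: ('a elem set, 'a span_class) smcat"
    by (rule symmetric_monoidal_Span_FinSet)
  show ?thesis
  proof (unfold_locales, goal_cases)
    case (1 f)
    then show ?case by (auto simp: Iso_def AutSt_def)
  next
    case (2 f)
    then show ?case by (auto simp: Iso_def AutSt_def)
  next
    case (3 s)
    then show ?case by (auto intro!: aut_map_in_hom_Iso aut_iso_ident)
  next
    case (4 f s t g u)
    then obtain \<alpha> \<beta> \<alpha>' \<beta>' where *: "aut_iso s t \<alpha> \<beta>" "aut_iso t u \<alpha>' \<beta>'"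
      "f = aut_map s t \<alpha>" "g = aut_map t u \<alpha>'"
      by (auto simp: hom_Iso_iff)
    then show ?case
      using aut_map_in_hom_Iso[OF aut_iso_comp[OF *(1,2)]] by (simp add: aut_iso_AutSt_comp[OF *(1)])
  next
    case (7 f s t g s' t')
    then obtain \<alpha> \<beta> \<alpha>' \<beta>' where *: "aut_iso s t \<alpha> \<beta>" "aut_iso s' t' \<alpha>' \<beta>'"
      "f = aut_map s t \<alpha>" "g = aut_map s' t' \<alpha>'"
      by (auto simp: hom_Iso_iff)
    then show ?case
      using aut_map_in_hom_Iso[OF aut_iso_prod[OF *(1,2)]] by (simp add: AutSt_atens)
  next
    case (18 f s t)
    then obtain \<alpha> \<beta> where *: "aut_iso s t \<alpha> \<beta>" "f = aut_map s t \<alpha>"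
      by (auto simp: hom_Iso_iff)
    then show ?case
      using aut_iso_in[OF *(1)] aut_iso_funcset[OF *(1)] by (simp add: AMap_U fun_span_in_hom)
  next
    case (19 s)
    then show ?case by (simp add: AMap_U[OF aut_iso_ident])
  next
    case (20 f s t g u)
    then obtain \<alpha> \<beta> \<alpha>' \<beta>' where *: "aut_iso s t \<alpha> \<beta>" "aut_iso t u \<alpha>' \<beta>'"
      "f = aut_map s t \<alpha>" "g = aut_map t u \<alpha>'"
      by (auto simp: hom_Iso_iff)
    show ?case
      using * AMap_U[OF aut_iso_comp[OF *(1,2)]] aut_iso_in[OF *(1)] aut_iso_in[OF *(2)]
        aut_iso_funcset[OF *(1)] aut_iso_funcset[OF *(2)]
      by (simp add: AMap_U aut_iso_AutSt_comp[OF *(1)])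
  next
    case (21 f s t g s' t')
    then obtain \<alpha> \<beta> \<alpha>' \<beta>' where *: "aut_iso s t \<alpha> \<beta>" "aut_iso s' t' \<alpha>' \<beta>'"
      "f = aut_map s t \<alpha>" "g = aut_map s' t' \<alpha>'"
      by (auto simp: hom_Iso_iff)
    then show ?case
      using AMap_U[OF aut_iso_prod[OF *(1,2)]] aut_iso_in[OF *(1)] aut_iso_in[OF *(2)]
        aut_iso_funcset[OF *(1)] aut_iso_funcset[OF *(2)]
      by (simp add: AMap_U AutSt_atens)
  next
    case (26 f s t g)
    then obtain \<alpha> \<beta> \<alpha>' \<beta>' where *: "aut_iso s t \<alpha> \<beta>" "aut_iso s t \<alpha>' \<beta>'"
      "f = aut_map s t \<alpha>" "g = aut_map s t \<alpha>'"
      by (auto simp: hom_Iso_iff)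
    then show ?case
      using 26(3) aut_iso_in[OF *(1)] aut_iso_funcset[OF *(1)] aut_iso_funcset[OF *(2)]
      by (simp add: AMap_U fun_span_eq_iff aut_map_eq_iff)
  qed (simp_all add: AMap_U[OF aut_iso_structure(1)] AMap_U[OF aut_iso_structure(2)]
      AMap_U[OF aut_iso_structure(3)] AMap_U[OF aut_iso_structure(4)]
      aut_map_in_hom_Iso[OF aut_iso_structure(1)] aut_map_in_hom_Iso[OF aut_iso_structure(2)]
      aut_map_in_hom_Iso[OF aut_iso_structure(3)] aut_map_in_hom_Iso[OF aut_iso_structure(4)]
      is_iso_Iso[OF aut_iso_structure(1)] is_iso_Iso[OF aut_iso_structure(2)]
      is_iso_Iso[OF aut_iso_structure(3)])
qed

theorem symmetric_strong_monoidal_U_AutSpan: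
  "symmetric_strong_monoidal_functor (Iso AutSt) Span_FinSet U_AutSpan"
proof -
  \<comment> \<open>\<open>U_AutSpan\<close> literally has the shape of the strict functor built in
    \<open>symmetric_strong_monoidal\<close>, with identities as comparison maps.\<close>
  have "U_AutSpan = \<lparr>OMap = States, AMap = AMap U_AutSpan,
     Mult = \<lambda>s t. ident Span_FinSet (States s \<otimes>\<^bsub>Span_FinSet\<^esub> States t),
     UnitMap = ident Span_FinSet (Unity Span_FinSet)\<rparr>"
    by (simp add: U_AutSpan_def)
  then show ?thesis
    using faithful_strict_functor.symmetric_strong_monoidal[OF faithful_U_AutSpan] by metis
qed

section \<open>Automata as stateful processes\<close>

abbreviation st_pairs' :: "'a elem set \<Rightarrow> 'a elem set \<Rightarrow> ('a aut_space \<times> 'a span_class) set" where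
  "st_pairs' \<equiv> st_pairs Span_FinSet (Iso AutSt) U_AutSpan"

abbreviation st_slide' ::
    "'a elem set \<Rightarrow> 'a elem set \<Rightarrow> (('a aut_space \<times> 'a span_class) \<times> ('a aut_space \<times> 'a span_class)) set"
  where "st_slide' \<equiv> st_slide Span_FinSet (Iso AutSt) U_AutSpan"

abbreviation st_equiv' ::
    "'a elem set \<Rightarrow> 'a elem set \<Rightarrow> (('a aut_space \<times> 'a span_class) \<times> ('a aut_space \<times> 'a span_class)) set"
  where "st_equiv' \<equiv> st_equiv Span_FinSet (Iso AutSt) U_AutSpan"

definition underlying_span :: "'a span_aut \<Rightarrow> 'a span" where
  "underlying_span a = \<lparr>Head = Trans a, Lleg = (\<lambda>e. Pr (Src a e) (Llab a e)),
     Rleg = (\<lambda>e. Pr (Tgt a e) (Rlab a e))\<rparr>"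

definition process :: "'a elem set \<Rightarrow> 'a elem set \<Rightarrow> 'a span_aut \<Rightarrow> 'a aut_space \<times> 'a span_class" where
  "process A B a = (space a,
     span_class (pairs (States (space a)) A) (pairs (States (space a)) B) (underlying_span a))"

definition aut_of_span :: "'a aut_space \<Rightarrow> 'a span \<Rightarrow> 'a span_aut" where
  "aut_of_span s x = \<lparr>Trans = Head x, space = s, Src = (\<lambda>e. p1 (Lleg x e)), Tgt = (\<lambda>e. p1 (Rleg x e)),
     Llab = (\<lambda>e. p2 (Lleg x e)), Rlab = (\<lambda>e. p2 (Rleg x e))\<rparr>"

lemma underlying_span_in:
  "a \<in> span_auts A B \<Longrightarrow>
    underlying_span a \<in> spans (pairs (States (space a)) A) (pairs (States (space a)) B)"
  by (auto simp: underlying_span_def span_auts_def spans_def Pi_iff)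

lemma space_in: "a \<in> span_auts A B \<Longrightarrow> space a \<in> aut_spaces"
  by (simp add: span_auts_def)

lemma span_isoI:
  assumes "x \<in> spans A B" "y \<in> spans A B" "inverse_on (Head x) (Head y) \<phi> \<psi>"
    "\<And>e. e \<in> Head x \<Longrightarrow> Lleg y (\<phi> e) = Lleg x e \<and> Rleg y (\<phi> e) = Rleg x e"
  shows "(x, y) \<in> span_iso A B"
  using assms by (auto simp: span_iso_def dest!: inverse_on_bij_betw)

lemma aut_of_span_in:
  "s \<in> aut_spaces \<Longrightarrow> x \<in> spans (pairs (States s) A) (pairs (States s) B) \<Longrightarrow>
    aut_of_span s x \<in> span_auts A B"
  by (fastforce simp: aut_of_span_def span_auts_def spans_def Pi_iff in_pairs_iff)

text \<open>On the head a leg takes values in pairs and is rebuilt from its two components. Off the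
  head it may differ, so the spans are isomorphic rather than equal.\<close>

lemma process_aut_of_span:
  assumes s: "s \<in> aut_spaces" and x: "x \<in> spans (pairs (States s) A) (pairs (States s) B)"
  shows "process A B (aut_of_span s x) = (s, span_class (pairs (States s) A) (pairs (States s) B) x)"
proof -
  have "(underlying_span (aut_of_span s x), x) \<in> span_iso (pairs (States s) A) (pairs (States s) B)"
    using x underlying_span_in[OF aut_of_span_in[OF s x]]
    by (intro span_isoI[where \<phi> = id and \<psi> = id])
      (fastforce simp: underlying_span_def aut_of_span_def inverse_on_def spans_def Pi_iff in_pairs_iff)+
  then show ?thesis
    unfolding process_def by (simp add: span_class_eqI) (simp add: aut_of_span_def span_class_eqI)
qed

text \<open>Every process comes from an automaton, so all operations of \<open>St\<close> need to be
  evaluated only on processes of automata.\<close>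

lemma st_pairs_eq:
  assumes "finite A" "finite B"
  shows "st_pairs' A B = process A B ` span_auts A B"
proof (intro set_eqI iffI)
  fix p assume "p \<in> st_pairs' A B"
  then obtain s x where "p = (s, span_class (pairs (States s) A) (pairs (States s) B) x)"
    "s \<in> aut_spaces" "x \<in> spans (pairs (States s) A) (pairs (States s) B)"
    by (auto simp: st_pairs_def Span_hom_iff)
  then show "p \<in> process A B ` span_auts A B"
    using process_aut_of_span[of s x A B] aut_of_span_in[of s x A B] by (metis imageI)
next
  fix p assume "p \<in> process A B ` span_auts A B"
  then show "p \<in> st_pairs' A B"
    using assms by (auto simp: st_pairs_def process_def space_in intro!: span_class_in_hom underlying_span_in)
qed

lemma span_aut_iso_in: "(a, b) \<in> span_aut_iso A B \<Longrightarrow> a \<in> span_auts A B \<and> b \<in> span_auts A B"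
  by (simp add: span_aut_iso_def)

text \<open>Equality of processes forces equal state spaces but determines the span only up to a
  bijection of heads. This gives an isomorphism of automata that is the identity on states.\<close>

lemma process_inject:
  assumes "a \<in> span_auts A B" "b \<in> span_auts A B" "process A B a = process A B b"
  shows "(a, b) \<in> span_aut_iso A B"
proof -
  have sp: "space a = space b"
    using assms(3) by (simp add: process_def)
  have "(underlying_span a, underlying_span b) \<in>
      span_iso (pairs (States (space b)) A) (pairs (States (space b)) B)"
    using assms sp underlying_span_in[OF assms(1)] underlying_span_in[OF assms(2)]
    by (simp add: process_def span_class_eq_iff)
  then obtain \<phi> where "bij_betw \<phi> (Trans a) (Trans b)"
    "\<forall>e\<in>Trans a. Src b (\<phi> e) = Src a e \<and> Tgt b (\<phi> e) = Tgt a e \<and> Llab b (\<phi> e) = Llab a e \<and> Rlab b (\<phi> e) = Rlab a e"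
    by (auto simp: span_iso_def underlying_span_def)
  then show ?thesis
    using assms(1,2) sp
    by (intro span_aut_isoI[where \<alpha> = id and \<beta> = id and \<phi> = \<phi> and \<psi> = "inv_into (Trans a) \<phi>"])
      (auto simp: inverse_on_structure intro: bij_betw_inverse_on)
qed

section \<open>Slides as isomorphisms of automata\<close>

lemma AMap_U_atens_ident:
  assumes "aut_iso s t \<alpha> \<beta>" "finite A"
  shows "AMap U_AutSpan (aut_map s t \<alpha>) \<boxtimes>\<^bsub>Span_FinSet\<^esub> ident Span_FinSet A =
      fun_span (pairs (States s) A) (pairs (States t) A) (map_pr \<alpha> id)"
    and "inverse_on (pairs (States s) A) (pairs (States t) A) (map_pr \<alpha> id) (map_pr \<beta> id)"
    and "map_pr \<alpha> id \<in> pairs (States s) A \<rightarrow> pairs (States t) A"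
    and "map_pr \<beta> id \<in> pairs (States t) A \<rightarrow> pairs (States s) A"
  using assms aut_iso_in[OF assms(1)] aut_iso_funcset[OF assms(1)] aut_iso_funcset[OF aut_iso_inverse[OF assms(1)]]
  by (auto simp: AMap_U[OF assms(1)] Pi_iff inverse_on_def aut_iso_def)

text \<open>Every isomorphism of automata is already a single slide, because its bijection of transitions
  is absorbed by the isomorphism classes of spans.\<close>

lemma st_slide_eq:
  assumes A: "finite A" and B: "finite B"
  shows "st_slide' A B = {(process A B a, process A B b) | a b. (a, b) \<in> span_aut_iso A B}"
proof (intro set_eqI iffI)
  fix p assume "p \<in> st_slide' A B"
  then obtain s t \<alpha> \<beta> y where iso: "aut_iso s t \<alpha> \<beta>"
    and y: "y \<in> spans (pairs (States t) A) (pairs (States s) B)"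
    and p: "p = ((s, (AMap U_AutSpan (aut_map s t \<alpha>) \<boxtimes>\<^bsub>Span_FinSet\<^esub> ident Span_FinSet A)
                  \<Zcomp>\<^bsub>Span_FinSet\<^esub> span_class (pairs (States t) A) (pairs (States s) B) y),
                (t, span_class (pairs (States t) A) (pairs (States s) B) y \<Zcomp>\<^bsub>Span_FinSet\<^esub>
                  (AMap U_AutSpan (aut_map s t \<alpha>) \<boxtimes>\<^bsub>Span_FinSet\<^esub> ident Span_FinSet B)))"
    unfolding st_slide_def hom_Iso_iff by (auto simp: Span_hom_iff)
  note st = aut_iso_in[OF iso]
  note funA = AMap_U_atens_ident[OF iso A] and funB = AMap_U_atens_ident[OF iso B]
  \<comment> \<open>The two ends of the slide: precomposition moves the sources back along
    \<open>\<beta>\<close>, postcomposition moves the targets forward along \<open>\<alpha>\<close>.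
    The head stays that of y, so the transitions will correspond by the identity.\<close>
  define x where "x = y\<lparr>Lleg := map_pr \<beta> id \<circ> Lleg y\<rparr>"
  define z where "z = y\<lparr>Rleg := map_pr \<alpha> id \<circ> Rleg y\<rparr>"
  have x: "x \<in> spans (pairs (States s) A) (pairs (States s) B)"
    unfolding x_def by (rule Lleg_update_in[OF y funA(4)])
  have z: "z \<in> spans (pairs (States t) A) (pairs (States t) B)"
    unfolding z_def by (rule Rleg_update_in[OF y funB(3)])
  have "p = (process A B (aut_of_span s x), process A B (aut_of_span t z))"
    using st A B unfolding p funA(1) funB(1) process_aut_of_span[OF conjunct1[OF st] x]
      process_aut_of_span[OF conjunct2[OF st] z]
    by (simp add: x_def z_def fun_comp_span_class[OF funA(2) y] span_class_comp_fun[OF y funB(3)])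
  moreover have "(aut_of_span s x, aut_of_span t z) \<in> span_aut_iso A B"
  proof (rule span_aut_isoI[where \<alpha> = \<alpha> and \<beta> = \<beta> and \<phi> = id and \<psi> = id])
    fix e assume "e \<in> Trans (aut_of_span s x)"
    then have "Lleg y e \<in> pairs (States t) A" "Rleg y e \<in> pairs (States s) B"
      using y by (auto simp: aut_of_span_def x_def spans_def)
    then show "Src (aut_of_span t z) (id e) = \<alpha> (Src (aut_of_span s x) e) \<and>
         Tgt (aut_of_span t z) (id e) = \<alpha> (Tgt (aut_of_span s x) e) \<and>
         Llab (aut_of_span t z) (id e) = Llab (aut_of_span s x) e \<and>
         Rlab (aut_of_span t z) (id e) = Rlab (aut_of_span s x) e"
      using iso by (auto simp: aut_of_span_def x_def z_def in_pairs_iff aut_iso_def inverse_on_def)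
  qed (use iso st aut_of_span_in[OF conjunct1[OF st] x] aut_of_span_in[OF conjunct2[OF st] z] in
      \<open>auto simp: aut_of_span_def aut_iso_def x_def z_def inverse_on_structure\<close>)
  ultimately show "p \<in> {(process A B a, process A B b) | a b. (a, b) \<in> span_aut_iso A B}"
    by blast
next
  fix p assume "p \<in> {(process A B a, process A B b) | a b. (a, b) \<in> span_aut_iso A B}"
  then obtain a b where p: "p = (process A B a, process A B b)" and "(a, b) \<in> span_aut_iso A B"
    by blast
  then show "p \<in> st_slide' A B"
  proof (elim span_aut_isoE)
    fix \<alpha> \<beta> \<phi> \<psi>
    let ?s = "space a" and ?t = "space b"
    assume a: "a \<in> span_auts A B" and b: "b \<in> span_auts A B"
      and \<alpha>: "inverse_on (States ?s) (States ?t) \<alpha> \<beta>" "\<alpha> (Init ?s) = Init ?t"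
        "\<And>s. s \<in> States ?s \<Longrightarrow> \<alpha> s \<in> Finals ?t \<longleftrightarrow> s \<in> Finals ?s"
      and \<phi>: "inverse_on (Trans a) (Trans b) \<phi> \<psi>"
        "\<And>e. e \<in> Trans a \<Longrightarrow> Src b (\<phi> e) = \<alpha> (Src a e) \<and> Tgt b (\<phi> e) = \<alpha> (Tgt a e) \<and>
          Llab b (\<phi> e) = Llab a e \<and> Rlab b (\<phi> e) = Rlab a e"
    have iso: "aut_iso ?s ?t \<alpha> \<beta>"
      using a b \<alpha> by (auto simp: aut_iso_def space_in)
    note st = aut_iso_in[OF iso]
    note funA = AMap_U_atens_ident[OF iso A] and funB = AMap_U_atens_ident[OF iso B]
    \<comment> \<open>The span to slide: sources are already translated to the states of b, targets
      are still states of a. Precomposition undoes the translation and gives a; postcomposition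
      translates the targets as well and gives b up to \<open>\<phi>\<close>.\<close>
    define y where "y = \<lparr>Head = Trans a, Lleg = (\<lambda>e. Pr (\<alpha> (Src a e)) (Llab a e)),
      Rleg = (\<lambda>e. Pr (Tgt a e) (Rlab a e))\<rparr>"
    have y: "y \<in> spans (pairs (States ?t) A) (pairs (States ?s) B)"
      using a \<alpha>(1) by (auto simp: y_def spans_def span_auts_def Pi_iff inverse_on_def)
    have "(y\<lparr>Lleg := map_pr \<beta> id \<circ> Lleg y\<rparr>, underlying_span a)
        \<in> span_iso (pairs (States ?s) A) (pairs (States ?s) B)"
      using \<alpha>(1) a by (intro span_isoI[where \<phi> = id and \<psi> = id] Lleg_update_in[OF y funA(4)] underlying_span_in)
        (auto simp: y_def underlying_span_def inverse_on_def span_auts_def Pi_iff)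
    moreover have "(y\<lparr>Rleg := map_pr \<alpha> id \<circ> Rleg y\<rparr>, underlying_span b)
        \<in> span_iso (pairs (States ?t) A) (pairs (States ?t) B)"
      using \<phi> b by (intro span_isoI[where \<phi> = \<phi> and \<psi> = \<psi>] Rleg_update_in[OF y funB(3)] underlying_span_in)
        (auto simp: y_def underlying_span_def)
    ultimately have "p = ((?s, (AMap U_AutSpan (aut_map ?s ?t \<alpha>) \<boxtimes>\<^bsub>Span_FinSet\<^esub> ident Span_FinSet A)
                  \<Zcomp>\<^bsub>Span_FinSet\<^esub> span_class (pairs (States ?t) A) (pairs (States ?s) B) y),
                (?t, span_class (pairs (States ?t) A) (pairs (States ?s) B) y \<Zcomp>\<^bsub>Span_FinSet\<^esub>
                  (AMap U_AutSpan (aut_map ?s ?t \<alpha>) \<boxtimes>\<^bsub>Span_FinSet\<^esub> ident Span_FinSet B)))"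
      using st A B unfolding p funA(1) funB(1) process_def
      by (simp add: fun_comp_span_class[OF funA(2) y] span_class_comp_fun[OF y funB(3)] span_class_eqI)
    moreover have "span_class (pairs (States ?t) A) (pairs (States ?s) B) y
        \<in> hom Span_FinSet (pairs (States ?t) A) (pairs (States ?s) B)"
      using st A B y by (simp add: span_class_in_hom)
    ultimately show ?thesis
      using st aut_map_in_hom_Iso[OF iso] unfolding st_slide_def OMap_U Iso_simps Span_simps by blast
  qed
qed

text \<open>Slides are already symmetric and transitive, so the reflexive transitive closure adds
  only the diagonal. Within \<open>st_pairs\<close> the diagonal is covered by reflexivity of
  isomorphism, as every process comes from an automaton.\<close>

lemma st_equiv_eq:
  assumes "finite A" "finite B"
  shows "st_equiv' A B = {(process A B a, process A B b) | a b. (a, b) \<in> span_aut_iso A B}" (is "_ = ?E")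
proof -
  have "sym (span_aut_iso A B)" and tr: "trans (span_aut_iso A B)"
    using equiv_span_aut_iso[of A B] by (auto simp: equiv_def)
  then have "?E \<union> ?E\<inverse> = ?E"
    by (auto dest: symD)
  moreover have "trans ?E"
  proof (rule transI)
    fix p q r assume pq: "(p, q) \<in> ?E" and qr: "(q, r) \<in> ?E"
    from pq obtain a b where 1: "p = process A B a" "q = process A B b" "(a, b) \<in> span_aut_iso A B"
      by blast
    from qr obtain b' c where 2: "q = process A B b'" "r = process A B c" "(b', c) \<in> span_aut_iso A B"
      by blast
    \<comment> \<open>The middle process may be presented by two different automata;
      \<open>process_inject\<close> bridges them.\<close>
    have "(b, b') \<in> span_aut_iso A B"
      using span_aut_iso_in[OF 1(3)] span_aut_iso_in[OF 2(3)] 1(2) 2(1) by (simp add: process_inject)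
    then have "(a, c) \<in> span_aut_iso A B"
      using 1(3) 2(3) tr by (meson transD)
    then show "(p, r) \<in> ?E" using 1 2 by blast
  qed
  then have "?E\<^sup>* = ?E \<union> Id"
    by (simp only: rtrancl_trancl_reflcl[of ?E] trancl_id)
  moreover have "?E \<subseteq> st_pairs' A B \<times> st_pairs' A B"
    unfolding st_pairs_eq[OF assms] by (auto dest: span_aut_iso_in)
  moreover have "Id \<inter> (st_pairs' A B \<times> st_pairs' A B) \<subseteq> ?E"
    unfolding st_pairs_eq[OF assms] by (auto intro: span_aut_iso_refl)
  moreover have "(E \<union> Id) \<inter> P = E" if "E \<subseteq> P" "Id \<inter> P \<subseteq> E"
    for E P :: "(('a aut_space \<times> 'a span_class) \<times> ('a aut_space \<times> 'a span_class)) set"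
    using that by blast
  ultimately show ?thesis
    unfolding st_equiv_def st_slide_eq[OF assms] by (simp only:)
qed

lemma process_in: "finite A \<Longrightarrow> finite B \<Longrightarrow> a \<in> span_auts A B \<Longrightarrow> process A B a \<in> st_pairs' A B"
  by (simp add: st_pairs_eq)

lemma st_equiv_process_iff:
  assumes "finite A" "finite B" "a \<in> span_auts A B" "b \<in> span_auts A B"
  shows "(process A B a, process A B b) \<in> st_equiv' A B \<longleftrightarrow> (a, b) \<in> span_aut_iso A B"
proof
  assume "(process A B a, process A B b) \<in> st_equiv' A B"
  then obtain a' b' where *: "process A B a = process A B a'" "process A B b' = process A B b"
    "(a', b') \<in> span_aut_iso A B"
    unfolding st_equiv_eq[OF assms(1,2)] by auto
  then have "(a, a') \<in> span_aut_iso A B" "(b', b) \<in> span_aut_iso A B"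
    using assms(3,4) span_aut_iso_in[OF *(3)] by (auto intro: process_inject)
  then show "(a, b) \<in> span_aut_iso A B"
    using *(3) equiv_span_aut_iso[of A B] unfolding equiv_def by (meson transD)
qed (auto simp: st_equiv_eq[OF assms(1,2)])

lemma equiv_st_equiv:
  assumes "finite A" "finite B"
  shows "equiv (st_pairs' A B) (st_equiv' A B)"
proof (rule equivI)
  show "st_equiv' A B \<subseteq> st_pairs' A B \<times> st_pairs' A B"
    by (auto simp: st_equiv_def)
  show "refl_on (st_pairs' A B) (st_equiv' A B)"
    by (rule refl_onI) (auto simp: st_equiv_def)
  show "sym (st_equiv' A B)"
    unfolding st_equiv_def by (intro sym_Int sym_rtrancl) (auto simp: sym_def)
  show "trans (st_equiv' A B)"
    unfolding st_equiv_def by (intro trans_Int trans_rtrancl) (auto simp: trans_def)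
qed

definition process_class ::
    "'a elem set \<Rightarrow> 'a elem set \<Rightarrow> 'a span_aut \<Rightarrow>
      'a elem set \<times> 'a elem set \<times> ('a aut_space \<times> 'a span_class) set" where
  "process_class A B a = st_arr Span_FinSet (Iso AutSt) U_AutSpan A B (process A B a)"

lemma process_class_eq_iff:
  assumes "finite A" "finite B" "a \<in> span_auts A B" "b \<in> span_auts A B"
  shows "process_class A B a = process_class A B b \<longleftrightarrow> aut_class A B a = aut_class A B b"
  using assms unfolding process_class_def st_arr_def
  by (simp add: eq_equiv_class_iff[OF equiv_st_equiv] process_in st_equiv_process_iff aut_class_eq_iff)

section \<open>Evaluating composition and product of processes\<close>

lemma inv_arr_fun_span:
  assumes "inverse_on A B f g" "finite A" "finite B"
  shows "inv_arr Span_FinSet (fun_span A B f) = fun_span B A g"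
proof -
  interpret symmetric_monoidal_category "Span_FinSet :: ('a elem set, 'a span_class) smcat"
    by (rule symmetric_monoidal_Span_FinSet)
  show ?thesis
    by (rule inv_arr_eqI[OF fun_span_inverse[OF assms]])
qed

lemma inv_arr_structure [simp]:
  "\<lbrakk>finite A; finite B; finite D\<rbrakk> \<Longrightarrow>
    inv_arr Span_FinSet (fun_span (pairs (pairs A B) D) (pairs A (pairs B D)) assoc_pr) =
    fun_span (pairs A (pairs B D)) (pairs (pairs A B) D) unassoc_pr"
  "finite A \<Longrightarrow> inv_arr Span_FinSet (fun_span A A id) = fun_span A A id"
  by (simp_all add: inv_arr_fun_span inverse_on_structure)

lemma Mult_U [simp]:
  "Mult U_AutSpan s t = fun_span (pairs (States s) (States t)) (pairs (States s) (States t)) id"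
  by (simp add: U_AutSpan_def)

lemma interchange_eq:
  assumes [simp]: "finite W" "finite X" "finite Y" "finite Z"
  shows "interchange Span_FinSet W X Y Z =
    fun_span (pairs (pairs W X) (pairs Y Z)) (pairs (pairs W Y) (pairs X Z)) mid_pr"
proof -
  have [simp]: "unassoc_pr \<in> pairs A (pairs B D) \<rightarrow> pairs (pairs A B) D"
    "assoc_pr \<in> pairs (pairs A B) D \<rightarrow> pairs A (pairs B D)"
    "swap_pr \<in> pairs A B \<rightarrow> pairs B A" for A B D :: "'a elem set"
    by auto
  show ?thesis
    by (auto simp: interchange_def in_pairs_iff intro!: fun_span_cong)
qed

text \<open>All factors but \<open>id \<otimes> f\<close> and \<open>id \<otimes> g\<close> are
  spans of bijections and only relabel legs, as recorded by the spans \<open>z1\<close> to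
  \<open>z7\<close>. The one genuine pullback is \<open>z5\<close>.\<close>

lemma st_seq_process:
  assumes a: "a \<in> span_auts A B" and b: "b \<in> span_auts B D" and [simp]: "finite A" "finite B" "finite D"
  shows "st_seq Span_FinSet (Iso AutSt) U_AutSpan A B D (process A B a) (process B D b) =
    process A D (span_aut_comp a b)"
proof -
  define X where "X = States (space a)"
  define Y where "Y = States (space b)"
  have [simp]: "finite X" "finite Y"
    using space_in[OF a] space_in[OF b] by (simp_all add: X_def Y_def)
  define x where "x = underlying_span a"
  define y where "y = underlying_span b"
  have x: "x \<in> spans (pairs X A) (pairs X B)" and y: "y \<in> spans (pairs Y B) (pairs Y D)"
    using underlying_span_in[OF a] underlying_span_in[OF b] by (simp_all add: x_def y_def X_def Y_def)
  let ?I = "\<lambda>X. \<lparr>Head = X, Lleg = id, Rleg = id\<rparr> :: 'a span"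
  have I: "?I X \<in> spans X X" "?I Y \<in> spans Y Y"
    by (auto intro!: fun_in_spans)
  let ?c = "comp Span_FinSet"
  \<comment> \<open>Composition associates to the left, so the three bijections in front of the
    first process merge into one. Its inverse \<open>pre'\<close> is what relabels the left
    leg.\<close>
  let ?pre = "fun_span (pairs (pairs X Y) A) (pairs Y (pairs X A)) (\<lambda>e. Pr (p2 (p1 e)) (Pr (p1 (p1 e)) (p2 e)))"
  have pre: "?c (?c (inv_arr Span_FinSet (fun_span (pairs X Y) (pairs X Y) id) \<boxtimes>\<^bsub>Span_FinSet\<^esub> fun_span A A id)
      (fun_span (pairs X Y) (pairs Y X) swap_pr \<boxtimes>\<^bsub>Span_FinSet\<^esub> fun_span A A id))
      (fun_span (pairs (pairs Y X) A) (pairs Y (pairs X A)) assoc_pr) = ?pre"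
    by (auto simp: in_pairs_iff intro!: fun_span_cong)
  define pre' where "pre' = (\<lambda>e. Pr (Pr (p1 (p2 e)) (p1 e)) (p2 (p2 e)) :: 'a elem)"
  have pre': "inverse_on (pairs (pairs X Y) A) (pairs Y (pairs X A))
      (\<lambda>e. Pr (p2 (p1 e)) (Pr (p1 (p1 e)) (p2 e))) pre'"
    by (auto simp: inverse_on_def pre'_def)
  have f: "fun_span Y Y id \<boxtimes>\<^bsub>Span_FinSet\<^esub> span_class (pairs X A) (pairs X B) x =
      span_class (pairs Y (pairs X A)) (pairs Y (pairs X B)) (span_prod (?I Y) x)"
    by (simp add: fun_span_eq Span_atens I x)
  have g: "fun_span X X id \<boxtimes>\<^bsub>Span_FinSet\<^esub> span_class (pairs Y B) (pairs Y D) y =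
      span_class (pairs X (pairs Y B)) (pairs X (pairs Y D)) (span_prod (?I X) y)"
    by (simp add: fun_span_eq Span_atens I y)
  note z0 = span_prod_in[OF I(2) x] and w = span_prod_in[OF I(1) y]
  define z1 where "z1 = (span_prod (?I Y) x)\<lparr>Lleg := pre' \<circ> Lleg (span_prod (?I Y) x)\<rparr>"
  have z1: "z1 \<in> spans (pairs (pairs X Y) A) (pairs Y (pairs X B))"
    unfolding z1_def by (rule Lleg_update_in[OF z0]) (auto simp: pre'_def)
  define z2 where "z2 = z1\<lparr>Rleg := unassoc_pr \<circ> Rleg z1\<rparr>"
  have z2: "z2 \<in> spans (pairs (pairs X Y) A) (pairs (pairs Y X) B)"
    unfolding z2_def by (rule Rleg_update_in[OF z1]) auto
  define z3 where "z3 = z2\<lparr>Rleg := map_pr swap_pr id \<circ> Rleg z2\<rparr>"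
  have z3: "z3 \<in> spans (pairs (pairs X Y) A) (pairs (pairs X Y) B)"
    unfolding z3_def by (rule Rleg_update_in[OF z2]) auto
  define z4 where "z4 = z3\<lparr>Rleg := assoc_pr \<circ> Rleg z3\<rparr>"
  have z4: "z4 \<in> spans (pairs (pairs X Y) A) (pairs X (pairs Y B))"
    unfolding z4_def by (rule Rleg_update_in[OF z3]) auto
  define z5 where "z5 = span_comp z4 (span_prod (?I X) y)"
  have z5: "z5 \<in> spans (pairs (pairs X Y) A) (pairs X (pairs Y D))"
    unfolding z5_def by (rule span_comp_in[OF z4 w])
  define z6 where "z6 = z5\<lparr>Rleg := unassoc_pr \<circ> Rleg z5\<rparr>"
  have z6: "z6 \<in> spans (pairs (pairs X Y) A) (pairs (pairs X Y) D)"
    unfolding z6_def by (rule Rleg_update_in[OF z5]) auto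
  define z7 where "z7 = z6\<lparr>Rleg := map_pr id id \<circ> Rleg z6\<rparr>"
  have z7: "z7 \<in> spans (pairs (pairs X Y) A) (pairs (pairs X Y) D)"
    unfolding z7_def by (rule Rleg_update_in[OF z6]) auto
  have c1: "?c ?pre (span_class (pairs Y (pairs X A)) (pairs Y (pairs X B)) (span_prod (?I Y) x)) =
      span_class (pairs (pairs X Y) A) (pairs Y (pairs X B)) z1"
    by (simp add: fun_comp_span_class[OF pre' z0] z1_def)
  have c2: "?c (span_class (pairs (pairs X Y) A) (pairs Y (pairs X B)) z1)
      (inv_arr Span_FinSet (fun_span (pairs (pairs Y X) B) (pairs Y (pairs X B)) assoc_pr)) =
      span_class (pairs (pairs X Y) A) (pairs (pairs Y X) B) z2"
    by (simp add: span_class_comp_fun[OF z1] z2_def)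
  have c3: "?c (span_class (pairs (pairs X Y) A) (pairs (pairs Y X) B) z2)
      (fun_span (pairs Y X) (pairs X Y) swap_pr \<boxtimes>\<^bsub>Span_FinSet\<^esub> fun_span B B id) =
      span_class (pairs (pairs X Y) A) (pairs (pairs X Y) B) z3"
    by (simp add: span_class_comp_fun[OF z2] z3_def)
  have c4: "?c (span_class (pairs (pairs X Y) A) (pairs (pairs X Y) B) z3)
      (fun_span (pairs (pairs X Y) B) (pairs X (pairs Y B)) assoc_pr) =
      span_class (pairs (pairs X Y) A) (pairs X (pairs Y B)) z4"
    by (simp add: span_class_comp_fun[OF z3] z4_def)
  have c5: "?c (span_class (pairs (pairs X Y) A) (pairs X (pairs Y B)) z4)
      (span_class (pairs X (pairs Y B)) (pairs X (pairs Y D)) (span_prod (?I X) y)) =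
      span_class (pairs (pairs X Y) A) (pairs X (pairs Y D)) z5"
    by (simp add: Span_comp[OF z4 w] z5_def)
  have c6: "?c (span_class (pairs (pairs X Y) A) (pairs X (pairs Y D)) z5)
      (inv_arr Span_FinSet (fun_span (pairs (pairs X Y) D) (pairs X (pairs Y D)) assoc_pr)) =
      span_class (pairs (pairs X Y) A) (pairs (pairs X Y) D) z6"
    by (simp add: span_class_comp_fun[OF z5] z6_def)
  have c7: "?c (span_class (pairs (pairs X Y) A) (pairs (pairs X Y) D) z6)
      (fun_span (pairs X Y) (pairs X Y) id \<boxtimes>\<^bsub>Span_FinSet\<^esub> fun_span D D id) =
      span_class (pairs (pairs X Y) A) (pairs (pairs X Y) D) z7"
    by (simp add: span_class_comp_fun[OF z6] z7_def)
  have "(z7, underlying_span (span_aut_comp a b)) \<in> span_iso (pairs (pairs X Y) A) (pairs (pairs X Y) D)"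
  \<comment> \<open>\<open>\<psi>\<close> restores the idle states as the pullback dictates: while a
    moves, the second component waits at the source of the transition of b; while b moves, the first
    rests at the target of the transition of a. The rest of the pullback condition is agreement of
    the labels in B.\<close>
  proof (rule span_isoI[where \<phi> = "\<lambda>e. Pr (p2 (p1 e)) (p2 (p2 e))"
        and \<psi> = "\<lambda>e. Pr (Pr (Src b (p2 e)) (p1 e)) (Pr (Tgt a (p1 e)) (p2 e))"])
    show "underlying_span (span_aut_comp a b) \<in> spans (pairs (pairs X Y) A) (pairs (pairs X Y) D)"
      using underlying_span_in[OF span_aut_comp_in[OF a b]] by (simp add: X_def Y_def span_aut_comp_def)
  qed (use z7 a b in \<open>auto simp: z7_def z6_def z5_def z4_def z3_def z2_def z1_def x_def y_def X_def Y_def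
      underlying_span_def span_aut_comp_def span_comp_def span_prod_def in_pairs_iff inverse_on_def
      pre'_def span_auts_def Pi_iff\<close>)
  then show ?thesis
    unfolding st_seq_def process_def prod.case Let_def OMap_U Mult_U Span_simps Iso_simps
      X_def[symmetric] Y_def[symmetric] x_def[symmetric] y_def[symmetric]
      pre f g c1 c2 c3 c4 c5 c6 c7
    by (simp add: span_aut_comp_def X_def Y_def span_class_eqI)
qed

text \<open>The product of the two spans is surrounded by bijections only, so no pullback arises:
  the transitions are unchanged and just the legs are reordered.\<close>

lemma st_par_process:
  assumes a: "a \<in> span_auts A B" and b: "b \<in> span_auts A' B'"
    and [simp]: "finite A" "finite B" "finite A'" "finite B'"
  shows "st_par Span_FinSet (Iso AutSt) U_AutSpan A B A' B' (process A B a) (process A' B' b) =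
    process (pairs A A') (pairs B B') (span_aut_prod a b)"
proof -
  define X where "X = States (space a)"
  define Y where "Y = States (space b)"
  have [simp]: "finite X" "finite Y"
    using space_in[OF a] space_in[OF b] by (simp_all add: X_def Y_def)
  define x where "x = underlying_span a"
  define y where "y = underlying_span b"
  have x: "x \<in> spans (pairs X A) (pairs X B)" and y: "y \<in> spans (pairs Y A') (pairs Y B')"
    using underlying_span_in[OF a] underlying_span_in[OF b] by (simp_all add: x_def y_def X_def Y_def)
  let ?c = "comp Span_FinSet"
  let ?XY = "pairs X Y" and ?AA = "pairs A A'" and ?BB = "pairs B B'"
  have pre: "?c (inv_arr Span_FinSet (fun_span ?XY ?XY id) \<boxtimes>\<^bsub>Span_FinSet\<^esub> fun_span ?AA ?AA id)
      (interchange Span_FinSet X Y A A') =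
      fun_span (pairs ?XY ?AA) (pairs (pairs X A) (pairs Y A')) mid_pr"
    by (auto simp: interchange_eq in_pairs_iff intro!: fun_span_cong)
  have mid: "inverse_on (pairs ?XY ?AA) (pairs (pairs X A) (pairs Y A')) mid_pr mid_pr"
    by (auto simp: inverse_on_def)
  note z0 = span_prod_in[OF x y]
  define z1 where "z1 = (span_prod x y)\<lparr>Lleg := mid_pr \<circ> Lleg (span_prod x y)\<rparr>"
  have z1: "z1 \<in> spans (pairs ?XY ?AA) (pairs (pairs X B) (pairs Y B'))"
    unfolding z1_def by (rule Lleg_update_in[OF z0]) auto
  define z2 where "z2 = z1\<lparr>Rleg := mid_pr \<circ> Rleg z1\<rparr>"
  have z2: "z2 \<in> spans (pairs ?XY ?AA) (pairs ?XY ?BB)"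
    unfolding z2_def by (rule Rleg_update_in[OF z1]) auto
  define z3 where "z3 = z2\<lparr>Rleg := map_pr id id \<circ> Rleg z2\<rparr>"
  have z3: "z3 \<in> spans (pairs ?XY ?AA) (pairs ?XY ?BB)"
    unfolding z3_def by (rule Rleg_update_in[OF z2]) auto
  have c1: "?c (fun_span (pairs ?XY ?AA) (pairs (pairs X A) (pairs Y A')) mid_pr)
      (span_class (pairs X A) (pairs X B) x \<boxtimes>\<^bsub>Span_FinSet\<^esub> span_class (pairs Y A') (pairs Y B') y) =
      span_class (pairs ?XY ?AA) (pairs (pairs X B) (pairs Y B')) z1"
    by (simp add: Span_atens[OF x y] fun_comp_span_class[OF mid z0] z1_def)
  have c2: "?c (span_class (pairs ?XY ?AA) (pairs (pairs X B) (pairs Y B')) z1)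
      (interchange Span_FinSet X B Y B') = span_class (pairs ?XY ?AA) (pairs ?XY ?BB) z2"
    by (simp add: interchange_eq span_class_comp_fun[OF z1] z2_def)
  have c3: "?c (span_class (pairs ?XY ?AA) (pairs ?XY ?BB) z2)
      (fun_span ?XY ?XY id \<boxtimes>\<^bsub>Span_FinSet\<^esub> fun_span ?BB ?BB id) = span_class (pairs ?XY ?AA) (pairs ?XY ?BB) z3"
    by (subst fun_span_atens) (auto simp: span_class_comp_fun[OF z2] z3_def in_pairs_iff)
  have "(z3, underlying_span (span_aut_prod a b)) \<in> span_iso (pairs ?XY ?AA) (pairs ?XY ?BB)"
  proof (rule span_isoI[where \<phi> = id and \<psi> = id])
    show "underlying_span (span_aut_prod a b) \<in> spans (pairs ?XY ?AA) (pairs ?XY ?BB)"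
      using underlying_span_in[OF span_aut_prod_in[OF a b]] by (simp add: X_def Y_def span_aut_prod_def)
  qed (use z3 in \<open>auto simp: z3_def z2_def z1_def x_def y_def underlying_span_def span_aut_prod_def
      span_prod_def in_pairs_iff inverse_on_def\<close>)
  then show ?thesis
    unfolding st_par_def process_def prod.case Let_def OMap_U Mult_U Span_simps Iso_simps
      X_def[symmetric] Y_def[symmetric] x_def[symmetric] y_def[symmetric] pre c1 c2 c3
    by (simp add: span_aut_prod_def X_def Y_def span_class_eqI)
qed

section \<open>The isomorphism\<close>

abbreviation St_Span :: "('a elem set, 'a elem set \<times> 'a elem set \<times> ('a aut_space \<times> 'a span_class) set) smcat" where
  "St_Span \<equiv> St Span_FinSet (Iso AutSt) U_AutSpan"

text \<open>With the unit as state space, the head consisting of the pairs \<open>Pr Point a\<close>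
  collapses to A. So the structure maps of \<open>St\<close> are the processes of function
  automata.\<close>

lemma st_incl_fun_span:
  assumes "finite A" "finite B" "f \<in> A \<rightarrow> B"
  shows "st_incl Span_FinSet (Iso AutSt) U_AutSpan (fun_span A B f) = process_class A B (fun_aut A f)"
proof -
  have 1: "map_pr id f \<in> pairs {Point} A \<rightarrow> pairs {Point} B"
    using assms by (auto simp: Pi_iff)
  have 2: "fun_aut A f \<in> span_auts A B"
    using assms by (simp add: fun_aut_in)
  have "(\<lparr>Head = pairs {Point} A, Lleg = id, Rleg = map_pr id f\<rparr>, underlying_span (fun_aut A f))
      \<in> span_iso (pairs {Point} A) (pairs {Point} B)"
    using assms fun_in_spans[OF _ 1] underlying_span_in[OF 2]
    by (intro span_isoI[where \<phi> = p2 and \<psi> = "Pr Point"])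
      (auto simp: inverse_on_structure underlying_span_def in_pairs_iff)
  then have "process A B (fun_aut A f) = (aut_space_unit, fun_span (pairs {Point} A) (pairs {Point} B) (map_pr id f))"
    by (simp add: process_def fun_span_eq span_class_eqI)
  then show ?thesis
    using assms by (simp add: st_incl_def process_class_def) (simp add: fun_span_def Span_FinSet_def)
qed

text \<open>The identity of \<open>St\<close> is built from the identity of a tensor, whereas
  \<open>st_incl\<close> gives a tensor of identities; the two functions agree on pairs.\<close>

lemma process_class_ident:
  assumes "finite A"
  shows "process_class A A (fun_aut A id) =
    st_arr Span_FinSet (Iso AutSt) U_AutSpan A A (aut_space_unit, fun_span (pairs {Point} A) (pairs {Point} A) id)"
proof -
  have "fun_span (pairs {Point} A) (pairs {Point} A) (map_pr id id) = fun_span (pairs {Point} A) (pairs {Point} A) id"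
    using assms by (intro fun_span_cong) (auto simp: in_pairs_iff)
  then show ?thesis
    using assms st_incl_fun_span[of A A id]
    by (simp add: st_incl_def) (simp add: fun_span_def Span_FinSet_def)
qed

lemma St_simps [simp]:
  "Obj St_Span = {A. finite A}"
  "otens St_Span = pairs"
  "Unity St_Span = {Point}"
  "finite A \<Longrightarrow> ident St_Span A = process_class A A (fun_aut A id)"
  "\<lbrakk>finite A; finite B; finite D\<rbrakk> \<Longrightarrow> Assoc St_Span A B D =
    process_class (pairs (pairs A B) D) (pairs A (pairs B D)) (fun_aut (pairs (pairs A B) D) assoc_pr)"
  "finite A \<Longrightarrow> LUnit St_Span A = process_class (pairs {Point} A) A (fun_aut (pairs {Point} A) p2)"
  "finite A \<Longrightarrow> RUnit St_Span A = process_class (pairs A {Point}) A (fun_aut (pairs A {Point}) p1)"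
  "\<lbrakk>finite A; finite B\<rbrakk> \<Longrightarrow>
    Symm St_Span A B = process_class (pairs A B) (pairs B A) (fun_aut (pairs A B) swap_pr)"
  by (simp_all add: St_def st_incl_fun_span process_class_ident)

section \<open>Arrows and operations of the process category on representatives\<close>

lemma St_hom_iff:
  "f \<in> hom St_Span A B \<longleftrightarrow> finite A \<and> finite B \<and> (\<exists>a\<in>span_auts A B. f = process_class A B a)"
  by (cases f, auto simp: hom_def St_def process_class_def st_arr_def quotient_def st_pairs_eq) blast

text \<open>Equivalent processes come from isomorphic automata, so well-definedness on classes is
  inherited from \<open>span_aut_comp_cong\<close>.\<close>

lemma St_comp:
  assumes "a \<in> span_auts A B" "b \<in> span_auts B D" "finite A" "finite B" "finite D"
  shows "process_class A B a \<Zcomp>\<^bsub>St_Span\<^esub> process_class B D b = process_class A D (span_aut_comp a b)"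
proof -
  have "congruent2 (st_equiv' A B) (st_equiv' B D)
      (\<lambda>x y. st_equiv' A D `` {st_seq Span_FinSet (Iso AutSt) U_AutSpan A B D x y})"
  proof (rule congruent2I')
    fix x x' y y' assume "(x, x') \<in> st_equiv' A B" "(y, y') \<in> st_equiv' B D"
    then obtain a a' b b' where *: "(a, a') \<in> span_aut_iso A B" "(b, b') \<in> span_aut_iso B D"
      and xy: "x = process A B a" "x' = process A B a'" "y = process B D b" "y' = process B D b'"
      unfolding st_equiv_eq[OF assms(3,4)] st_equiv_eq[OF assms(4,5)] by blast
    have "(process A D (span_aut_comp a b), process A D (span_aut_comp a' b')) \<in> st_equiv' A D"
      unfolding st_equiv_eq[OF assms(3,5)] using span_aut_comp_cong[OF *] by blast
    then show "st_equiv' A D `` {st_seq Span_FinSet (Iso AutSt) U_AutSpan A B D x y} =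
        st_equiv' A D `` {st_seq Span_FinSet (Iso AutSt) U_AutSpan A B D x' y'}"
      unfolding xy using span_aut_iso_in[OF *(1)] span_aut_iso_in[OF *(2)] assms(3-5)
      by (simp add: st_seq_process equiv_class_eq[OF equiv_st_equiv])
  qed
  from UN_equiv_class2[OF equiv_st_equiv equiv_st_equiv this, of "process A B a" "process B D b"] assms
  show ?thesis
    by (simp add: process_class_def st_arr_def St_def process_in st_seq_process)
qed

lemma St_atens:
  assumes "a \<in> span_auts A B" "b \<in> span_auts A' B'" "finite A" "finite B" "finite A'" "finite B'"
  shows "process_class A B a \<boxtimes>\<^bsub>St_Span\<^esub> process_class A' B' b =
    process_class (pairs A A') (pairs B B') (span_aut_prod a b)"
proof -
  let ?A = "pairs A A'" and ?B = "pairs B B'"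
  have fin: "finite ?A" "finite ?B" using assms by simp_all
  have "congruent2 (st_equiv' A B) (st_equiv' A' B')
      (\<lambda>x y. st_equiv' ?A ?B `` {st_par Span_FinSet (Iso AutSt) U_AutSpan A B A' B' x y})"
  proof (rule congruent2I')
    fix x x' y y' assume "(x, x') \<in> st_equiv' A B" "(y, y') \<in> st_equiv' A' B'"
    then obtain a a' b b' where *: "(a, a') \<in> span_aut_iso A B" "(b, b') \<in> span_aut_iso A' B'"
      and xy: "x = process A B a" "x' = process A B a'" "y = process A' B' b" "y' = process A' B' b'"
      unfolding st_equiv_eq[OF assms(3,4)] st_equiv_eq[OF assms(5,6)] by blast
    have "(process ?A ?B (span_aut_prod a b), process ?A ?B (span_aut_prod a' b')) \<in> st_equiv' ?A ?B"
      unfolding st_equiv_eq[OF fin] using span_aut_prod_cong[OF *] by blast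
    then show "st_equiv' ?A ?B `` {st_par Span_FinSet (Iso AutSt) U_AutSpan A B A' B' x y} =
        st_equiv' ?A ?B `` {st_par Span_FinSet (Iso AutSt) U_AutSpan A B A' B' x' y'}"
      unfolding xy using span_aut_iso_in[OF *(1)] span_aut_iso_in[OF *(2)] assms(3-6)
      by (simp add: st_par_process equiv_class_eq[OF equiv_st_equiv])
  qed
  from UN_equiv_class2[OF equiv_st_equiv equiv_st_equiv this, of "process A B a" "process A' B' b"] assms
  show ?thesis
    by (simp add: process_class_def st_arr_def St_def process_in st_par_process)
qed

lemma process_class_in_hom:
  "\<lbrakk>finite A; finite B; a \<in> span_auts A B\<rbrakk> \<Longrightarrow> process_class A B a \<in> hom St_Span A B"
  by (auto simp: St_hom_iff)

text \<open>The category laws of \<open>St\<close> are not yet available here, so both composites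
  with the inverse are evaluated among automata and transported by
  \<open>process_class_eq_iff\<close>.\<close>

lemma is_iso_process_class:
  assumes "inverse_on A B f g" and fin: "finite A" "finite B"
  shows "is_iso St_Span (process_class A B (fun_aut A f))"
proof -
  have fg: "f \<in> A \<rightarrow> B" "g \<in> B \<rightarrow> A" using assms by (auto simp: inverse_on_def)
  note auts = fun_aut_in[OF fin(1) fg(1)] fun_aut_in[OF fin(2) fg(2)]
  have "aut_class A A (span_aut_comp (fun_aut A f) (fun_aut B g)) = aut_class A A (fun_aut A id)"
    "aut_class B B (span_aut_comp (fun_aut B g) (fun_aut A f)) = aut_class B B (fun_aut B id)"
    unfolding SpanAut_comp[OF auts, symmetric] SpanAut_comp[OF auts(2,1), symmetric]
      fun_span_aut_eq[symmetric]
    using assms fg by (auto simp: inverse_on_def intro!: fun_span_aut_cong)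
  then have "process_class A B (fun_aut A f) \<Zcomp>\<^bsub>St_Span\<^esub> process_class B A (fun_aut B g) = ident St_Span A"
    "process_class B A (fun_aut B g) \<Zcomp>\<^bsub>St_Span\<^esub> process_class A B (fun_aut A f) = ident St_Span B"
    using fin auts by (simp_all add: St_comp process_class_eq_iff span_aut_comp_in fun_aut_in)
  moreover note process_class_in_hom[OF fin auts(1)] process_class_in_hom[OF fin(2,1) auts(2)]
  ultimately show ?thesis
    by (auto simp: is_iso_def inverse_arrs_def hom_def intro!: exI[of _ "process_class B A (fun_aut B g)"]
        simp del: split_paired_Ex St_simps)
qed

section \<open>Mutually inverse comparison functors\<close>

definition to_St :: "'a span_aut_class \<Rightarrow> 'a elem set \<times> 'a elem set \<times> ('a aut_space \<times> 'a span_class) set" where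
  "to_St = (\<lambda>(A, B, X). (A, B, \<Union>a\<in>X. st_equiv' A B `` {process A B a}))"

text \<open>The preimage of an equivalence class under \<open>process\<close> is already a full
  isomorphism class of automata, by \<open>st_equiv_process_iff\<close>.\<close>

definition from_St :: "'a elem set \<times> 'a elem set \<times> ('a aut_space \<times> 'a span_class) set \<Rightarrow> 'a span_aut_class" where
  "from_St = (\<lambda>(A, B, X). (A, B, {a \<in> span_auts A B. process A B a \<in> X}))"

lemma to_St:
  assumes "finite A" "finite B" "a \<in> span_auts A B"
  shows "to_St (aut_class A B a) = process_class A B a"
proof -
  have "(\<lambda>a. st_equiv' A B `` {process A B a}) respects span_aut_iso A B"
    by (intro congruentI equiv_class_eq[OF equiv_st_equiv[OF assms(1,2)]])
      (auto simp del: split_paired_Ex simp: st_equiv_eq[OF assms(1,2)])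
  from UN_equiv_class[OF equiv_span_aut_iso this assms(3)]
  show ?thesis by (simp add: to_St_def aut_class_def process_class_def st_arr_def)
qed

lemma from_St:
  assumes "finite A" "finite B" "a \<in> span_auts A B"
  shows "from_St (process_class A B a) = aut_class A B a"
  using assms st_equiv_process_iff[OF assms]
  by (auto simp: from_St_def aut_class_def process_class_def st_arr_def dest: span_aut_iso_in)

lemma faithful_from_St: "faithful_strict_functor SpanAut St_Span (\<lambda>A. A) from_St"
proof -
  interpret symmetric_monoidal_category "SpanAut :: ('a elem set, 'a span_aut_class) smcat"
    by (rule symmetric_monoidal_SpanAut)
  show ?thesis
  proof (unfold_locales, goal_cases)
    case (1 f)
    then show ?case by (auto simp: St_def)
  next
    case (2 f)
    then show ?case by (auto simp: St_def)
  next
    case (4 f A B g D)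
    then show ?case by (auto simp: St_hom_iff St_comp intro!: bexI span_aut_comp_in)
  next
    case (7 f A B g A' B')
    then show ?case by (auto simp: St_hom_iff St_atens intro!: bexI span_aut_prod_in)
  next
    case (18 f A B)
    then show ?case by (auto simp: St_hom_iff from_St intro!: aut_class_in_hom)
  next
    case (20 f A B g E)
    then show ?case by (auto simp: St_hom_iff from_St St_comp SpanAut_comp span_aut_comp_in)
  next
    case (21 f A B g A' B')
    then show ?case by (auto simp: St_hom_iff from_St St_atens SpanAut_atens span_aut_prod_in)
  next
    case (26 f A B g)
    then show ?case by (auto simp: St_hom_iff from_St process_class_eq_iff)
  qed (auto simp: from_St fun_aut_in fun_span_aut_eq in_pairs_iff is_iso_process_class[OF inverse_on_structure(1)]
      is_iso_process_class[OF inverse_on_structure(2)] is_iso_process_class[OF inverse_on_structure(3)]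
      intro!: process_class_in_hom fun_aut_in)
qed

theorem symmetric_monoidal_St_Span: "symmetric_monoidal_category St_Span"
  using faithful_strict_functor.source_monoidal[OF faithful_from_St] .

lemma faithful_to_St: "faithful_strict_functor St_Span SpanAut (\<lambda>A. A) to_St"
proof -
  interpret S: symmetric_monoidal_category "SpanAut :: ('a elem set, 'a span_aut_class) smcat"
    by (rule symmetric_monoidal_SpanAut)
  interpret T: symmetric_monoidal_category "St_Span :: ('a elem set, _) smcat"
    by (rule symmetric_monoidal_St_Span)
  show ?thesis
  proof (unfold_locales, goal_cases)
    \<comment> \<open>With both categories interpreted, only functor axioms remain: 4 is typing, 6
      composition, 7 tensor and 12 faithfulness.\<close>
    case (4 f A B)
    then show ?case by (auto simp: SpanAut_hom_iff to_St intro!: process_class_in_hom)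
  next
    case (6 f A B g E)
    then show ?case by (auto simp: SpanAut_hom_iff to_St St_comp SpanAut_comp span_aut_comp_in)
  next
    case (7 f A B g A' B')
    then show ?case by (auto simp: SpanAut_hom_iff to_St St_atens SpanAut_atens span_aut_prod_in)
  next
    case (12 f A B g)
    then show ?case by (auto simp: SpanAut_hom_iff to_St process_class_eq_iff)
  qed (auto simp: to_St fun_aut_in fun_span_aut_eq in_pairs_iff)
qed

lemma bij_betw_to_St: "bij_betw to_St (hom SpanAut A B) (hom St_Span A B)"
  by (rule bij_betw_byWitness[where f' = from_St], auto simp: SpanAut_hom_iff St_hom_iff to_St from_St)
    blast+

text \<open>\<open>St\<close> is defined for arbitrary records; the first conjunct certifies that it
  is applied here to a symmetric strong monoidal functor between symmetric monoidal
  categories.\<close>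

theorem proposition5p12:
  shows "symmetric_strong_monoidal_functor (Iso AutSt) Span_FinSet
           (U_AutSpan :: ('a aut_space, 'a aut_map, 'a elem set, 'a span_class) monfun) \<and>
         (SpanAut :: ('a elem set, 'a span_aut_class) smcat) \<cong>\<^sub>c
           St Span_FinSet (Iso AutSt)
             (U_AutSpan :: ('a aut_space, 'a aut_map, 'a elem set, 'a span_class) monfun)"
proof
  show "symmetric_strong_monoidal_functor (Iso AutSt) Span_FinSet
     (U_AutSpan :: ('a aut_space, 'a aut_map, 'a elem set, 'a span_class) monfun)"
    by (rule symmetric_strong_monoidal_U_AutSpan)
  show "(SpanAut :: ('a elem set, 'a span_aut_class) smcat) \<cong>\<^sub>c
      St Span_FinSet (Iso AutSt)
        (U_AutSpan :: ('a aut_space, 'a aut_map, 'a elem set, 'a span_class) monfun)"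
    unfolding isomorphic_categories_def
    \<comment> \<open>The functor is left schematic and is fixed by the first conjunct as the strict
      functor given by \<open>to_St\<close>.\<close>
    by (rule exI, rule conjI[OF faithful_strict_functor.symmetric_strong_monoidal[OF faithful_to_St]])
      (simp add: bij_betw_to_St, simp add: bij_betw_def)
qed

end
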